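(* For an odd prime $p$ the following conditions are equivalent: (1) $p$ is a Fermat prime; (2) $\mathrm{ST}^+(p-1,(\mathbb{Q},\tau_p))$ is minimal; (3) $\mathrm{ST}^+(p-1,\mathbb{Q}(i))$ is minimal.
   Context: All topological groups are Hausdorff. A Fermat prime is a prime number of the form $2^{2^n}+1$ with $n$ a non-negative integer. $(\mathbb{Q},\tau_p)$ is the field of rationals equipped with the $p$-adic topology; $\mathbb{Q}(i)\subset\mathbb{C}$ is the Gaussian rational field with the topology inherited from $\mathbb{C}$. For a topological field $\mathbb{F}$, $\mathrm{ST}^+(n,\mathbb{F})$ denotes the group of upper triangular $n\times n$ matrices over $\mathbb{F}$ of determinant $1$, with the topology inherited from $\mathbb{F}^{n^2}$. A topological group $G$ is minimal if every continuous group isomorphism $f\colon G\to H$ onto a (Hausdorff) topological group $H$ is a topological isomorphism; equivalently, if $G$ admits no strictly coarser Hausdorff group topology. *)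

theory Defs
  imports
    "HOL-Analysis.Abstract_Metric_Spaces"
    "HOL-Analysis.Function_Topology"
    "HOL-Algebra.Group"
    "HOL-Computational_Algebra.Squarefree"
    "Jordan_Normal_Form.Determinant"
begin

definition fermat_prime :: "nat \<Rightarrow> bool" where
  "fermat_prime p \<longleftrightarrow> prime p \<and> (\<exists>n::nat. p = 2 ^ (2 ^ n) + 1)"

definition topological_group :: "('a, 'm) monoid_scheme \<Rightarrow> 'a topology \<Rightarrow> bool" where
  "topological_group G T \<longleftrightarrow>
     group G \<and> topspace T = carrier G \<and> Hausdorff_space T \<and>
     continuous_map (prod_topology T T) T (\<lambda>(x, y). x \<otimes>\<^bsub>G\<^esub> y) \<and>
     continuous_map T T (\<lambda>x. inv\<^bsub>G\<^esub> x)"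

text \<open>The target group ranges over groups on the element type of the source. This loses no
  generality, since any isomorphic target can be transported along the isomorphism: see
  \<open>minimal_topological_groupD\<close> below, where the target has an arbitrary element type.\<close>

definition minimal_topological_group :: "('a, 'm) monoid_scheme \<Rightarrow> 'a topology \<Rightarrow> bool" where
  "minimal_topological_group G T \<longleftrightarrow>
     topological_group G T \<and>
     (\<forall>(H :: 'a monoid) S f.
        topological_group H S \<and> f \<in> iso G H \<and> continuous_map T S f
        \<longrightarrow> homeomorphic_map T S f)"

lemma topological_group_pullback:
  fixes G :: "('a, 'm) monoid_scheme" and H :: "('b, 'n) monoid_scheme"
  assumes G: "group G" and H: "topological_group H S" and f: "f \<in> iso G H"
  defines "P \<equiv> pullback_topology (carrier G) f S"
  shows "topological_group G P" and "homeomorphic_map P S f"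
proof -
  have gH: "group H" and tS: "topspace S = carrier H" and hS: "Hausdorff_space S"
    and mS: "continuous_map (prod_topology S S) S (\<lambda>(x, y). x \<otimes>\<^bsub>H\<^esub> y)"
    and iS: "continuous_map S S (\<lambda>x. inv\<^bsub>H\<^esub> x)"
    using H by (auto simp: topological_group_def)
  have bij: "bij_betw f (carrier G) (carrier H)" and hom: "f \<in> hom G H"
    using f by (auto simp: iso_def)
  interpret gh: group_hom G H f
    using G gH hom by (simp add: group_hom_def group_hom_axioms_def)
  have tP: "topspace P = carrier G"
    using bij by (auto simp: P_def topspace_pullback_topology tS bij_betw_def)
  have cf: "continuous_map P S f"
    unfolding P_def using continuous_map_pullback[OF continuous_map_id] by (simp add: o_def)
  have op: "open_map P S f"
    unfolding open_map_def P_def openin_pullback_topology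
  proof safe
    fix U assume "openin S U"
    moreover have "f ` (f -` U \<inter> carrier G) = U \<inter> carrier H"
      unfolding bij_betw_imp_surj_on[OF bij, symmetric] by auto
    ultimately show "openin S (f ` (f -` U \<inter> carrier G))"
      by (metis openin_subset tS inf.absorb1)
  qed
  show hP: "homeomorphic_map P S f"
    using cf op bij by (intro bijective_open_imp_homeomorphic_map) (auto simp: tP tS bij_betw_def)
  have "Hausdorff_space P"
    using hP hS homeomorphic_Hausdorff_space homeomorphic_map_imp_homeomorphic_space by blast
  moreover have "continuous_map (prod_topology P P) P (\<lambda>(x, y). x \<otimes>\<^bsub>G\<^esub> y)"
  unfolding P_def
  proof (rule continuous_map_pullback', fold P_def)
    have "continuous_map (prod_topology P P) (prod_topology S S) (\<lambda>(x, y). (f x, f y))"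
      using cf by (simp add: continuous_map_prod_top)
    from continuous_map_compose[OF this mS]
    show "continuous_map (prod_topology P P) S (f \<circ> (\<lambda>(x, y). x \<otimes>\<^bsub>G\<^esub> y))"
      by (rule continuous_map_eq) (auto simp: tP)
  qed (auto simp: tP)
  moreover have "continuous_map P P (\<lambda>x. inv\<^bsub>G\<^esub> x)"
  unfolding P_def
  proof (rule continuous_map_pullback', fold P_def)
    from continuous_map_compose[OF cf iS]
    show "continuous_map P S (f \<circ> (\<lambda>x. inv\<^bsub>G\<^esub> x))"
      by (rule continuous_map_eq) (auto simp: tP)
  qed (auto simp: tP)
  ultimately show "topological_group G P"
    using G tP by (simp add: topological_group_def)
qed

lemma minimal_topological_group_iff_coarser:
  fixes G :: "('a, 'm) monoid_scheme"
  shows "minimal_topological_group G T \<longleftrightarrow>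
    topological_group G T \<and>
    (\<forall>S. topological_group G S \<and> (\<forall>U. openin S U \<longrightarrow> openin T U) \<longrightarrow> S = T)"
    (is "?L \<longleftrightarrow> ?R")
proof
  assume L: ?L
  then have GT: "topological_group G T" by (simp add: minimal_topological_group_def)
  have "S = T" if S: "topological_group G S" and le: "\<And>U. openin S U \<Longrightarrow> openin T U" for S
  proof -
    define H :: "'a monoid" where
      "H = \<lparr>carrier = carrier G, mult = mult G, one = one G\<rparr>"
    have H: "carrier H = carrier G" "mult H = mult G" "one H = one G" "m_inv H = m_inv G"
      by (auto simp: H_def m_inv_def fun_eq_iff)
    have "group G" using S by (simp add: topological_group_def)
    then have "group H"
      by (intro groupI) (auto simp: H group.is_monoid monoid.m_closed monoid.m_assoc
          intro: group.l_inv_ex)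
    then have "topological_group H S"
      using S by (simp add: topological_group_def H)
    moreover have "id \<in> iso G H"
      by (auto simp: iso_def hom_def H)
    moreover have "continuous_map T S id"
      unfolding continuous_map_def
    proof (intro conjI allI impI)
      show "id \<in> topspace T \<rightarrow> topspace S"
        using GT S by (simp add: topological_group_def)
      fix U assume U: "openin S U"
      have "{x \<in> topspace T. id x \<in> U} = U"
        using openin_subset[OF le[OF U]] by auto
      then show "openin T {x \<in> topspace T. id x \<in> U}"
        using le[OF U] by simp
    qed
    ultimately have "homeomorphic_map T S id"
      using L unfolding minimal_topological_group_def by blast
    then show ?thesis by simp
  qed
  then show ?R using GT by blast
next
  assume R: ?R
  then have GT: "topological_group G T" by simp
  show ?L
    unfolding minimal_topological_group_def
  proof (intro conjI allI impI GT)
    fix H :: "'a monoid" and S f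
    assume a: "topological_group H S \<and> f \<in> iso G H \<and> continuous_map T S f"
    define P where "P = pullback_topology (carrier G) f S"
    have "group G" and tT: "topspace T = carrier G" using GT by (auto simp: topological_group_def)
    with a have P: "topological_group G P" "homeomorphic_map P S f"
      unfolding P_def by (blast intro: topological_group_pullback)+
    have "openin T U" if "openin P U" for U
    proof -
      from that obtain V where "openin S V" "U = f -` V \<inter> carrier G"
        by (auto simp: P_def openin_pullback_topology)
      moreover from this a have "openin T {x \<in> topspace T. f x \<in> V}"
        by (auto simp: continuous_map_def)
      moreover have "{x \<in> topspace T. f x \<in> V} = f -` V \<inter> carrier G" using tT by auto
      ultimately show ?thesis by simp
    qed
    with R P have "P = T" by blast
    with P show "homeomorphic_map T S f" by simp
  qed
qed

lemma minimal_topological_groupD: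
  fixes G :: "('a, 'm) monoid_scheme" and H :: "('b, 'n) monoid_scheme"
  assumes G: "minimal_topological_group G T"
    and H: "topological_group H S" and f: "f \<in> iso G H" "continuous_map T S f"
  shows "homeomorphic_map T S f"
proof -
  define P where "P = pullback_topology (carrier G) f S"
  have "group G" and tT: "topspace T = carrier G"
    using G by (auto simp: minimal_topological_group_def topological_group_def)
  with H f have P: "topological_group G P" "homeomorphic_map P S f"
    unfolding P_def by (blast intro: topological_group_pullback)+
  have "openin T U" if "openin P U" for U
  proof -
    from that obtain V where "openin S V" "U = f -` V \<inter> carrier G"
      by (auto simp: P_def openin_pullback_topology)
    moreover from this f have "openin T {x \<in> topspace T. f x \<in> V}"
      by (auto simp: continuous_map_def)
    moreover have "{x \<in> topspace T. f x \<in> V} = f -` V \<inter> carrier G" using tT by auto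
    ultimately show ?thesis by simp
  qed
  with G P(1) have "P = T" unfolding minimal_topological_group_iff_coarser by blast
  with P show ?thesis by simp
qed

text \<open>The field of scalars is a subset \<open>K\<close> of an ambient field type; its topology \<open>T\<close> is an
  abstract topology with \<open>topspace T = K\<close>.\<close>

definition ST_plus :: "nat \<Rightarrow> 'a::field set \<Rightarrow> 'a mat monoid" where
  "ST_plus n K =
     \<lparr>carrier = {A \<in> carrier_mat n n. elements_mat A \<subseteq> K \<and> upper_triangular A \<and> det A = 1},
      mult = (*), one = 1\<^sub>m n\<rparr>"

definition mat_entries :: "nat \<Rightarrow> 'a mat \<Rightarrow> nat \<times> nat \<Rightarrow> 'a" where
  "mat_entries n A = restrict (\<lambda>ij. A $$ ij) ({..<n} \<times> {..<n})"

text \<open>Pulling back along the injection \<open>mat_entries n\<close> into the product space indexed by the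
  \<open>n\<^sup>2\<close> positions gives the topology inherited from that product.\<close>

definition ST_plus_topology :: "nat \<Rightarrow> 'a::field topology \<Rightarrow> 'a mat topology" where
  "ST_plus_topology n T =
     pullback_topology (carrier (ST_plus n (topspace T))) (mat_entries n)
       (product_topology (\<lambda>_. T) ({..<n} \<times> {..<n}))"

lemma topspace_ST_plus_topology:
  "topspace (ST_plus_topology n T) = carrier (ST_plus n (topspace T))"
proof -
  have "mat_entries n A \<in> topspace (product_topology (\<lambda>_. T) ({..<n} \<times> {..<n}))"
    if "A \<in> carrier_mat n n" "elements_mat A \<subseteq> topspace T" for A
  proof -
    have "A $$ (i, j) \<in> topspace T" if "i < n" "j < n" for i j
      using elements_matI[OF \<open>A \<in> carrier_mat n n\<close> that refl] \<open>elements_mat A \<subseteq> topspace T\<close>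
      by (rule rev_subsetD)
    then show ?thesis by (auto simp: mat_entries_def PiE_iff)
  qed
  then show ?thesis
    by (auto simp: ST_plus_topology_def topspace_pullback_topology ST_plus_def
        simp del: topspace_product_topology)
qed

definition padic_val :: "nat \<Rightarrow> rat \<Rightarrow> int" where
  "padic_val p x = (case quotient_of x of (a, b) \<Rightarrow>
     int (multiplicity (int p) a) - int (multiplicity (int p) b))"

definition padic_abs :: "nat \<Rightarrow> rat \<Rightarrow> real" where
  "padic_abs p x = (if x = 0 then 0 else real p powi (- padic_val p x))"

definition padic_dist :: "nat \<Rightarrow> rat \<Rightarrow> rat \<Rightarrow> real" where
  "padic_dist p x y = padic_abs p (x - y)"

definition padic_topology :: "nat \<Rightarrow> rat topology" where
  "padic_topology p = Metric_space.mtopology UNIV (padic_dist p)"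

lemma padic_val_divide:
  assumes p: "prime p" and nz: "a \<noteq> 0" "b \<noteq> 0"
  shows "padic_val p (of_int a / of_int b) =
    int (multiplicity (int p) a) - int (multiplicity (int p) b)"
proof -
  obtain c d where cd: "quotient_of (of_int a / of_int b) = (c, d)" by fastforce
  have d: "d > 0" using quotient_of_denom_pos[OF cd] .
  have eq: "(of_int a / of_int b :: rat) = of_int c / of_int d" using quotient_of_div[OF cd] .
  then have "(of_int (a * d) :: rat) = of_int (c * b)" using nz d by (simp add: field_simps)
  then have ad: "a * d = c * b" using of_int_eq_iff by blast
  then have c: "c \<noteq> 0" using nz d by auto
  have pe: "prime_elem (int p)" using p by simp
  have "multiplicity (int p) (a * d) = multiplicity (int p) (c * b)" using ad by simp
  then have "multiplicity (int p) a + multiplicity (int p) d =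
      multiplicity (int p) c + multiplicity (int p) b"
    using nz c d pe by (simp add: prime_elem_multiplicity_mult_distrib)
  then show ?thesis using cd by (simp add: padic_val_def)
qed

lemma padic_val_add:
  assumes p: "prime p" and nz: "x \<noteq> 0" "y \<noteq> 0" "x + y \<noteq> 0"
  shows "min (padic_val p x) (padic_val p y) \<le> padic_val p (x + y)"
proof -
  obtain a b where ab: "quotient_of x = (a, b)" by fastforce
  obtain c d where cd: "quotient_of y = (c, d)" by fastforce
  have bd: "b > 0" "d > 0"
    using quotient_of_denom_pos[OF ab] quotient_of_denom_pos[OF cd] by auto
  have x: "x = of_int (a * d) / of_int (b * d)" and y: "y = of_int (c * b) / of_int (b * d)"
    using quotient_of_div[OF ab] quotient_of_div[OF cd] bd by (auto simp: field_simps)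
  have xy: "x + y = of_int (a * d + c * b) / of_int (b * d)"
    unfolding x y by (simp add: add_divide_distrib)
  have n: "a * d \<noteq> 0" "c * b \<noteq> 0" "b * d \<noteq> 0" using nz x y bd by auto
  have n': "a * d + c * b \<noteq> 0"
  proof
    assume "a * d + c * b = 0"
    with xy have "x + y = 0" by (simp only: of_int_0 div_0)
    with nz(3) show False by simp
  qed
  let ?m = "multiplicity (int p)"
  have "\<not> is_unit (int p)" using p by (simp add: prime_nat_iff)
  moreover have "int p ^ min (?m (a * d)) (?m (c * b)) dvd a * d + c * b"
    by (intro dvd_add multiplicity_dvd') auto
  ultimately have "min (?m (a * d)) (?m (c * b)) \<le> ?m (a * d + c * b)"
    using n' by (intro multiplicity_geI) auto
  then show ?thesis
    unfolding xy unfolding x y padic_val_divide[OF p n(1,3)] padic_val_divide[OF p n(2,3)]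
      padic_val_divide[OF p n' n(3)]
    by linarith
qed

lemma Metric_space_padic:
  assumes p: "prime p"
  shows "Metric_space UNIV (padic_dist p)"
proof
  have p1: "real p > 1" using prime_gt_1_nat[OF p] by simp
  have ge: "0 \<le> padic_abs p x" for x by (simp add: padic_abs_def)
  have z: "padic_abs p x = 0 \<longleftrightarrow> x = 0" for x using p1 by (simp add: padic_abs_def)
  have neg: "padic_abs p (- x) = padic_abs p x" for x
    by (cases "quotient_of x") (simp add: padic_abs_def padic_val_def rat_uminus_code)
  have add: "padic_abs p (x + y) \<le> padic_abs p x + padic_abs p y" for x y
  proof (cases "x = 0 \<or> y = 0 \<or> x + y = 0")
    case True
    then show ?thesis using ge[of x] ge[of y] by (auto simp: padic_abs_def)
  next
    case False
    then have "min (padic_val p x) (padic_val p y) \<le> padic_val p (x + y)"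
      using padic_val_add[OF p] by blast
    then have "padic_abs p (x + y) \<le> padic_abs p x \<or> padic_abs p (x + y) \<le> padic_abs p y"
      using False p1 by (auto simp: padic_abs_def min_le_iff_disj intro!: power_int_increasing)
    then show ?thesis using ge[of x] ge[of y] by linarith
  qed
  fix x y z :: rat
  show "0 \<le> padic_dist p x y" by (simp add: padic_dist_def ge)
  show "padic_dist p x y = padic_dist p y x"
    using neg[of "x - y"] by (simp add: padic_dist_def)
  show "padic_dist p x y = 0 \<longleftrightarrow> x = y" by (simp add: padic_dist_def z)
  show "padic_dist p x z \<le> padic_dist p x y + padic_dist p y z"
    using add[of "x - y" "y - z"] by (simp add: padic_dist_def)
qed

definition gaussian_rationals :: "complex set" where
  "gaussian_rationals = {Complex a b | a b. a \<in> \<rat> \<and> b \<in> \<rat>}"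

definition gaussian_topology :: "complex topology" where
  "gaussian_topology = subtopology euclidean gaussian_rationals"

lemma topspace_padic_topology:
  "prime p \<Longrightarrow> topspace (padic_topology p) = UNIV"
  by (simp add: padic_topology_def Metric_space.topspace_mtopology Metric_space_padic)

lemma topspace_gaussian_topology: "topspace gaussian_topology = gaussian_rationals"
  by (simp add: gaussian_topology_def)

end

theory Submission
  imports Defs "HOL-Number_Theory.Residue_Primitive_Roots"
begin

text \<open>Write \<open>n\<close> for \<open>p - 1\<close>. An odd prime \<open>p\<close> is a Fermat prime iff \<open>n\<close> is a power of two
  (\<open>fermat_prime_iff_power_of_two\<close>), so the point is that over both fields the triangular group of size
  \<open>n\<close> is minimal exactly when \<open>n\<close> is a power of two. What decides is the centre: the scalar matrices
  \<open>\<zeta> I\<close> with \<open>\<zeta> ^ n = 1\<close>. Over the completion of the field all \<open>n\<close>-th roots of unity are present, over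
  the field itself only a few of them, and a dense subgroup of a minimal group stays minimal iff it
  meets every nontrivial closed normal subgroup. The only prime order for which the field itself has a
  primitive root of unity is \<open>2\<close>. The argument below carries this out inside the field, with limits
  along filters in place of a completion.

  Suppose that an odd prime \<open>q\<close> divides \<open>n\<close>. Dividing the completed group by the central subgroup of
  order \<open>q\<close> induces a coarser group topology on the original group, which is Hausdorff because that
  subgroup meets the original group trivially. This topology can be described without the completion: it
  is generated by the functions \<open>A (i, j) / A (0, 0)\<close> and \<open>A (0, 0) ^ q\<close>
  (\<open>topological_group_projective_topology\<close>). It is strictly coarser as soon as the field contains a
  sequence \<open>x k\<close> that does not tend to \<open>1\<close> while \<open>x k ^ q\<close> does
  (\<open>not_minimal_if_missing_roots\<close>). Rational approximations of a primitive \<open>q\<close>-th root of unity are such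
  a sequence.

  Suppose that \<open>n\<close> is a power of two, and let \<open>\<sigma>\<close> be a coarser Hausdorff group topology. Consider
  the matrices \<open>I + x E\<close>, where \<open>E\<close> has its only nonzero entry in the upper right corner. The torus
  acts on \<open>x\<close> by multiplication with squares, and the differences of squares near \<open>1\<close> cover a
  neighbourhood of \<open>0\<close>; hence \<open>\<sigma>\<close> cannot have unbounded neighbourhoods there, and induces the given
  topology on this subgroup (\<open>corner_limit\<close>). Commutators with elementary matrices move the other entries of a
  matrix into the corner, and so a family \<open>h\<close> that tends to the identity in \<open>\<sigma>\<close> has ratios
  \<open>h (i, j) / h (l, l)\<close>, with \<open>l\<close> the last index, that tend to the entries of the identity matrix
  (\<open>ratio_limit\<close>). Since the determinant is \<open>1\<close>, also \<open>h (l, l) ^ n\<close> tends to \<open>1\<close>. If \<open>a\<^sup>2\<close>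
  tends to \<open>1\<close> then \<open>a\<close> can only accumulate at \<open>1\<close> and \<open>- 1\<close>; accumulation of \<open>h (l, l)\<close> at
  \<open>- 1\<close> would make \<open>h\<close> accumulate at \<open>- I\<close>, a matrix of the group different from the \<open>\<sigma>\<close>-limit
  \<open>I\<close>. Applied to \<open>h\<close> and its iterated squares this removes the exponent \<open>n\<close> factor by factor
  (\<open>last_limit_of_power\<close>), so \<open>h\<close> tends to the identity in the given topology.\<close>

section \<open>Limits in a valued subfield\<close>

text \<open>The absolute value is defined on the ambient field. The element of absolute value strictly between
  \<open>0\<close> and \<open>1\<close> makes the topology of the subfield nondiscrete, and it supplies the contracting torus
  element.\<close>

locale valued_subfield =
  fixes K :: "'a::field set" and v :: "'a \<Rightarrow> real"
  assumes zero_mem: "0 \<in> K" and one_mem: "1 \<in> K"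
    and add_closed: "\<And>x y. x \<in> K \<Longrightarrow> y \<in> K \<Longrightarrow> x + y \<in> K"
    and minus_closed: "\<And>x. x \<in> K \<Longrightarrow> - x \<in> K"
    and mult_closed: "\<And>x y. x \<in> K \<Longrightarrow> y \<in> K \<Longrightarrow> x * y \<in> K"
    and inverse_closed: "\<And>x. x \<in> K \<Longrightarrow> inverse x \<in> K"
    and v_nonneg: "\<And>x. 0 \<le> v x"
    and v_eq_0_iff: "\<And>x. v x = 0 \<longleftrightarrow> x = 0"
    and v_mult: "\<And>x y. v (x * y) = v x * v y"
    and v_triangle: "\<And>x y. v (x + y) \<le> v x + v y"
    and v_nontrivial: "\<exists>x\<in>K. 0 < v x \<and> v x < 1"
    and two_neq_0: "(2::'a) \<noteq> 0"
begin

lemma v_0 [simp]: "v 0 = 0" by (simp add: v_eq_0_iff)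

lemma v_1 [simp]: "v 1 = 1"
  using v_mult[of 1 1] v_eq_0_iff[of 1] by auto

lemma v_minus [simp]: "v (- x) = v x"
proof -
  have "v (-1) * v (-1) = 1" using v_mult[of "-1" "-1"] by simp
  then have "v (-1) = 1" using v_nonneg[of "-1"] by (metis abs_of_nonneg abs_square_eq_1 power2_eq_square)
  then show ?thesis using v_mult[of "-1" x] by simp
qed

lemma v_minus_commute: "v (x - y) = v (y - x)"
  using v_minus[of "x - y"] by simp

lemma v_inverse: "v (inverse x) = inverse (v x)"
proof (cases "x = 0")
  case False
  then have "v x * v (inverse x) = 1" using v_mult[of x "inverse x"] by simp
  then show ?thesis by (simp add: inverse_unique)
qed simp

lemma v_divide: "v (x / y) = v x / v y"
  by (simp add: divide_inverse v_mult v_inverse)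

lemma v_power: "v (x ^ k) = v x ^ k"
  by (induction k) (auto simp: v_mult)

lemma v_reverse_triangle: "\<bar>v x - v y\<bar> \<le> v (x - y)"
  using v_triangle[of "x - y" y] v_triangle[of "y - x" x] by (simp add: v_minus_commute[of y x])

lemma diff_closed: "x \<in> K \<Longrightarrow> y \<in> K \<Longrightarrow> x - y \<in> K"
  using add_closed[of x "- y"] minus_closed[of y] by simp

lemma divide_closed: "x \<in> K \<Longrightarrow> y \<in> K \<Longrightarrow> x / y \<in> K"
  by (simp add: divide_inverse mult_closed inverse_closed)

lemma power_closed: "x \<in> K \<Longrightarrow> x ^ k \<in> K"
  by (induction k) (auto simp: one_mem mult_closed)

lemma sum_closed: "(\<And>i. i \<in> I \<Longrightarrow> f i \<in> K) \<Longrightarrow> sum f I \<in> K"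
  by (induction I rule: infinite_finite_induct) (auto simp: zero_mem add_closed)

lemma prod_closed: "(\<And>i. i \<in> I \<Longrightarrow> f i \<in> K) \<Longrightarrow> prod f I \<in> K"
  by (induction I rule: infinite_finite_induct) (auto simp: one_mem mult_closed)

lemma two_closed: "2 \<in> K"
  using add_closed[OF one_mem one_mem] by simp

lemmas closed = zero_mem one_mem add_closed minus_closed mult_closed inverse_closed
  diff_closed divide_closed power_closed two_closed

sublocale Metric_space K "\<lambda>x y. v (x - y)"
proof
  show "v (x - z) \<le> v (x - y) + v (y - z)" for x y z
    using v_triangle[of "x - y" "y - z"] by simp
qed (auto simp: v_nonneg v_eq_0_iff v_minus_commute)

text \<open>Only the distances to the limit are constrained: membership in \<open>K\<close> is kept apart, so that the
  limit laws need no closure conditions.\<close>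

definition vtendsto :: "('b \<Rightarrow> 'a) \<Rightarrow> 'a \<Rightarrow> 'b filter \<Rightarrow> bool" where
  "vtendsto f c F \<longleftrightarrow> ((\<lambda>x. v (f x - c)) \<longlongrightarrow> 0) F"

lemma limitin_mtopology_iff:
  "limitin mtopology f c F \<longleftrightarrow> c \<in> K \<and> (\<forall>\<^sub>F x in F. f x \<in> K) \<and> vtendsto f c F"
proof -
  have "vtendsto f c F \<longleftrightarrow> (\<forall>\<epsilon>>0. \<forall>\<^sub>F x in F. v (f x - c) < \<epsilon>)"
    by (simp add: vtendsto_def tendsto_iff v_nonneg)
  moreover have "(\<forall>\<epsilon>>0. \<forall>\<^sub>F x in F. f x \<in> K \<and> v (f x - c) < \<epsilon>) \<longleftrightarrow>
      (\<forall>\<^sub>F x in F. f x \<in> K) \<and> (\<forall>\<epsilon>>0. \<forall>\<^sub>F x in F. v (f x - c) < \<epsilon>)"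
    by (force simp: eventually_conj_iff dest: spec[of _ "1::real"])
  ultimately show ?thesis by (simp add: limitin_metric)
qed

lemma vtendsto_squeeze:
  assumes "(g \<longlongrightarrow> (0::real)) F" "\<forall>\<^sub>F x in F. v (f x - c) \<le> g x"
  shows "vtendsto f c F"
  unfolding vtendsto_def
  by (rule tendsto_sandwich[OF _ assms(2) tendsto_const assms(1)]) (simp add: v_nonneg)

lemma vtendsto_const [simp, intro]: "vtendsto (\<lambda>_. c) c F"
  by (simp add: vtendsto_def)

lemma vtendsto_cong:
  assumes "\<forall>\<^sub>F x in F. f x = g x"
  shows "vtendsto f c F \<longleftrightarrow> vtendsto g c F"
  unfolding vtendsto_def using assms by (intro tendsto_cong) (auto elim: eventually_mono)

lemma vtendsto_transform_eventually:
  "vtendsto f c F \<Longrightarrow> \<forall>\<^sub>F x in F. f x = g x \<Longrightarrow> vtendsto g c F"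
  using vtendsto_cong by blast

lemma vtendsto_add:
  assumes "vtendsto f a F" "vtendsto g b F"
  shows "vtendsto (\<lambda>x. f x + g x) (a + b) F"
proof (rule vtendsto_squeeze)
  show "((\<lambda>x. v (f x - a) + v (g x - b)) \<longlongrightarrow> 0) F"
    using tendsto_add[OF assms[unfolded vtendsto_def]] by simp
  show "\<forall>\<^sub>F x in F. v (f x + g x - (a + b)) \<le> v (f x - a) + v (g x - b)"
    using v_triangle[of "f x - a" "g x - b" for x] by (simp add: algebra_simps)
qed

lemma vtendsto_minus: "vtendsto f a F \<Longrightarrow> vtendsto (\<lambda>x. - f x) (- a) F"
  by (simp add: vtendsto_def v_minus_commute)

lemma vtendsto_diff:
  "vtendsto f a F \<Longrightarrow> vtendsto g b F \<Longrightarrow> vtendsto (\<lambda>x. f x - g x) (a - b) F"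
  using vtendsto_add[of f a F "\<lambda>x. - g x" "- b"] vtendsto_minus[of g b F] by simp

lemma vtendsto_mult:
  assumes "vtendsto f a F" "vtendsto g b F"
  shows "vtendsto (\<lambda>x. f x * g x) (a * b) F"
proof (rule vtendsto_squeeze)
  note [tendsto_intros] = assms[unfolded vtendsto_def]
  have "((\<lambda>x. v (f x - a) * v (g x - b) + v (f x - a) * v b + v a * v (g x - b)) \<longlongrightarrow>
      0 * 0 + 0 * v b + v a * 0) F"
    by (intro tendsto_intros)
  then show "((\<lambda>x. v (f x - a) * v (g x - b) + v (f x - a) * v b + v a * v (g x - b)) \<longlongrightarrow> 0) F"
    by simp
  have "v (f x * g x - a * b) \<le> v (f x - a) * v (g x - b) + v (f x - a) * v b + v a * v (g x - b)" for x
  proof -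
    have "f x * g x - a * b = ((f x - a) * (g x - b) + (f x - a) * b) + a * (g x - b)"
      by (simp add: algebra_simps)
    then show ?thesis
      using v_triangle[of "(f x - a) * (g x - b) + (f x - a) * b" "a * (g x - b)"]
        v_triangle[of "(f x - a) * (g x - b)" "(f x - a) * b"]
      by (simp add: v_mult)
  qed
  then show "\<forall>\<^sub>F x in F. v (f x * g x - a * b) \<le>
      v (f x - a) * v (g x - b) + v (f x - a) * v b + v a * v (g x - b)"
    by simp
qed

lemma vtendsto_v: "vtendsto f a F \<Longrightarrow> ((\<lambda>x. v (f x)) \<longlongrightarrow> v a) F"
  unfolding vtendsto_def
  by (rule Lim_transform_bound[of "\<lambda>x. v (f x) - v a" "\<lambda>x. v (f x - a)", THEN LIM_zero_cancel])
    (auto simp: v_nonneg v_reverse_triangle)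

lemma vtendsto_inverse:
  assumes f: "vtendsto f a F" and a: "a \<noteq> 0"
  shows "vtendsto (\<lambda>x. inverse (f x)) (inverse a) F"
proof (rule vtendsto_squeeze)
  have va: "v a \<noteq> 0" using a by (simp add: v_eq_0_iff)
  have "((\<lambda>x. v (f x - a) / (v (f x) * v a)) \<longlongrightarrow> 0 / (v a * v a)) F"
    using va by (intro tendsto_intros vtendsto_v f f[unfolded vtendsto_def]) auto
  then show "((\<lambda>x. v (f x - a) / (v (f x) * v a)) \<longlongrightarrow> 0) F" by simp
  have "0 < v a" using va v_nonneg[of a] by simp
  then have "\<forall>\<^sub>F x in F. 0 < v (f x)"
    using vtendsto_v[OF f] by (simp add: order_tendstoD)
  then show "\<forall>\<^sub>F x in F. v (inverse (f x) - inverse a) \<le> v (f x - a) / (v (f x) * v a)"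
  proof eventually_elim
    case (elim x)
    then have "f x \<noteq> 0" by (auto simp: v_eq_0_iff)
    with a have "inverse (f x) - inverse a = (a - f x) / (f x * a)" by (simp add: field_simps)
    then show ?case by (simp add: v_divide v_mult v_minus_commute)
  qed
qed

lemma vtendsto_divide:
  "vtendsto f a F \<Longrightarrow> vtendsto g b F \<Longrightarrow> b \<noteq> 0 \<Longrightarrow> vtendsto (\<lambda>x. f x / g x) (a / b) F"
  unfolding divide_inverse by (intro vtendsto_mult vtendsto_inverse)

lemma vtendsto_power: "vtendsto f a F \<Longrightarrow> vtendsto (\<lambda>x. f x ^ k) (a ^ k) F"
  by (induction k) (auto intro: vtendsto_mult)

lemma vtendsto_sum:
  "(\<And>i. i \<in> I \<Longrightarrow> vtendsto (f i) (a i) F) \<Longrightarrow> vtendsto (\<lambda>x. \<Sum>i\<in>I. f i x) (\<Sum>i\<in>I. a i) F"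
  by (induction I rule: infinite_finite_induct) (auto intro: vtendsto_add)

lemma vtendsto_prod:
  "(\<And>i. i \<in> I \<Longrightarrow> vtendsto (f i) (a i) F) \<Longrightarrow> vtendsto (\<lambda>x. \<Prod>i\<in>I. f i x) (\<Prod>i\<in>I. a i) F"
  by (induction I rule: infinite_finite_induct) (auto intro: vtendsto_mult)

lemma vtendsto_mono: "vtendsto f a F \<Longrightarrow> G \<le> F \<Longrightarrow> vtendsto f a G"
  unfolding vtendsto_def by (rule tendsto_mono)

lemma vtendsto_inverse_at_infinity:
  assumes "filterlim (\<lambda>x. v (f x)) at_top F"
  shows "vtendsto (\<lambda>x. inverse (f x)) 0 F"
  unfolding vtendsto_def using tendsto_inverse_0_at_top[OF assms] by (simp add: v_inverse)

end

section \<open>Limits in topological groups and topologies generated by scalar functions\<close>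

lemma limitin_nhdsin_id: "a \<in> topspace X \<Longrightarrow> limitin X (\<lambda>x. x) a (nhdsin X a)"
  by (auto simp: limitin_def eventually_nhdsin)

lemma continuous_map_nhdsin:
  assumes "\<And>x. x \<in> topspace X \<Longrightarrow> limitin Y f (f x) (nhdsin X x)"
  shows "continuous_map X Y f"
  unfolding continuous_map_atin
proof
  fix x assume "x \<in> topspace X"
  from assms[OF this] show "limitin Y f (f x) (atin X x)"
    unfolding limitin_def atin_def by (auto intro: filter_leD[OF inf_le1])
qed

lemma openin_if_limitin_id:
  assumes top: "topspace S = topspace T"
    and lim: "\<And>a. a \<in> topspace T \<Longrightarrow> limitin S (\<lambda>x. x) a (nhdsin T a)"
    and U: "openin S U"
  shows "openin T U"
proof -
  have "continuous_map T S (\<lambda>x. x)" by (rule continuous_map_nhdsin) (rule lim)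
  from openin_continuous_map_preimage[OF this U] have "openin T {x \<in> topspace T. x \<in> U}" .
  moreover have "{x \<in> topspace T. x \<in> U} = U" using openin_subset[OF U] top by auto
  ultimately show ?thesis by simp
qed

lemma limitin_mono: "limitin X f l F \<Longrightarrow> G \<le> F \<Longrightarrow> limitin X f l G"
  by (auto simp: limitin_def intro: filter_leD)

lemma limitin_pullback_topology:
  "limitin (pullback_topology A f T) h l F \<longleftrightarrow>
     l \<in> A \<and> (\<forall>\<^sub>F x in F. h x \<in> A) \<and> limitin T (\<lambda>x. f (h x)) (f l) F"
    (is "?L \<longleftrightarrow> ?R")
proof
  assume L: ?L
  then have l: "f l \<in> topspace T" "l \<in> A"
    by (auto simp: limitin_def topspace_pullback_topology)
  have ev: "\<forall>\<^sub>F x in F. h x \<in> f -` U \<inter> A" if "openin T U" "f l \<in> U" for U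
  proof -
    have "openin (pullback_topology A f T) (f -` U \<inter> A)"
      using that(1) by (auto simp: openin_pullback_topology)
    then show ?thesis using limitinD[OF L] that(2) l(2) by blast
  qed
  have "\<forall>\<^sub>F x in F. h x \<in> A"
    using ev[OF openin_topspace l(1)] by (rule eventually_mono) auto
  moreover have "limitin T (\<lambda>x. f (h x)) (f l) F"
    unfolding limitin_def using l ev by (auto simp: eventually_conj_iff)
  ultimately show ?R using l by simp
next
  assume R: ?R
  then show ?L
    by (auto simp: limitin_def topspace_pullback_topology openin_pullback_topology eventually_conj_iff)
qed

lemma topological_group_limit_mult:
  assumes "topological_group G S" "limitin S f l F" "limitin S g m F"
  shows "limitin S (\<lambda>x. f x \<otimes>\<^bsub>G\<^esub> g x) (l \<otimes>\<^bsub>G\<^esub> m) F"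
proof -
  have "limitin (prod_topology S S) (\<lambda>x. (f x, g x)) (l, m) F"
    using assms by (simp add: limitin_pairwise o_def)
  moreover have "continuous_map (prod_topology S S) S (\<lambda>(x, y). x \<otimes>\<^bsub>G\<^esub> y)"
    using assms by (simp add: topological_group_def)
  ultimately have "limitin S ((\<lambda>(x, y). x \<otimes>\<^bsub>G\<^esub> y) \<circ> (\<lambda>x. (f x, g x)))
      ((\<lambda>(x, y). x \<otimes>\<^bsub>G\<^esub> y) (l, m)) F"
    by (rule continuous_map_limit[rotated])
  then show ?thesis by (simp add: o_def)
qed

lemma topological_group_limit_inv:
  assumes "topological_group G S" "limitin S f l F"
  shows "limitin S (\<lambda>x. inv\<^bsub>G\<^esub> (f x)) (inv\<^bsub>G\<^esub> l) F"
  using continuous_map_limit[of S S "\<lambda>x. inv\<^bsub>G\<^esub> x" f l F] assms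
  by (auto simp: topological_group_def o_def)

lemma topological_group_limit_carrier:
  assumes "topological_group G S" "limitin S f l F"
  shows "\<forall>\<^sub>F x in F. f x \<in> carrier G"
  using assms limitinD[OF assms(2) openin_topspace limitin_topspace[OF assms(2)]]
  by (simp add: topological_group_def)

text \<open>An equation \<open>a * c = b\<close> in which \<open>a\<close> and \<open>b\<close> converge forces \<open>c\<close> to converge. In this form the
  matrix identities below can be used without computing any inverse matrix.\<close>

lemma topological_group_limit_cancel_left:
  assumes S: "topological_group G S" and a: "limitin S a A F" and b: "limitin S b B F"
    and c: "\<forall>\<^sub>F x in F. c x \<in> carrier G" and eq: "\<forall>\<^sub>F x in F. a x \<otimes>\<^bsub>G\<^esub> c x = b x"
    and C: "C \<in> carrier G" "A \<otimes>\<^bsub>G\<^esub> C = B"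
  shows "limitin S c C F"
proof -
  interpret group G using S by (simp add: topological_group_def)
  have "A \<in> carrier G" using limitin_topspace[OF a] S by (simp add: topological_group_def)
  then have "inv\<^bsub>G\<^esub> A \<otimes>\<^bsub>G\<^esub> B = C" using C by (metis inv_solve_left' m_closed)
  moreover have "\<forall>\<^sub>F x in F. inv\<^bsub>G\<^esub> (a x) \<otimes>\<^bsub>G\<^esub> b x = c x"
    using c eq topological_group_limit_carrier[OF S a]
    by eventually_elim (metis inv_solve_left' m_closed)
  moreover have "limitin S (\<lambda>x. inv\<^bsub>G\<^esub> (a x) \<otimes>\<^bsub>G\<^esub> b x) (inv\<^bsub>G\<^esub> A \<otimes>\<^bsub>G\<^esub> B) F"
    by (intro topological_group_limit_mult[OF S] topological_group_limit_inv[OF S] a b)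
  ultimately show ?thesis by (auto intro: limitin_transform_eventually)
qed

lemma topological_group_limit_cancel_right:
  assumes S: "topological_group G S" and a: "limitin S a A F" and b: "limitin S b B F"
    and c: "\<forall>\<^sub>F x in F. c x \<in> carrier G" and eq: "\<forall>\<^sub>F x in F. c x \<otimes>\<^bsub>G\<^esub> a x = b x"
    and C: "C \<in> carrier G" "C \<otimes>\<^bsub>G\<^esub> A = B"
  shows "limitin S c C F"
proof -
  interpret group G using S by (simp add: topological_group_def)
  have "A \<in> carrier G" using limitin_topspace[OF a] S by (simp add: topological_group_def)
  then have "B \<otimes>\<^bsub>G\<^esub> inv\<^bsub>G\<^esub> A = C" using C by (metis inv_solve_right' m_closed)
  moreover have "\<forall>\<^sub>F x in F. b x \<otimes>\<^bsub>G\<^esub> inv\<^bsub>G\<^esub> (a x) = c x"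
    using c eq topological_group_limit_carrier[OF S a]
    by eventually_elim (metis inv_solve_right' m_closed)
  moreover have "limitin S (\<lambda>x. b x \<otimes>\<^bsub>G\<^esub> inv\<^bsub>G\<^esub> (a x)) (B \<otimes>\<^bsub>G\<^esub> inv\<^bsub>G\<^esub> A) F"
    by (intro topological_group_limit_mult[OF S] topological_group_limit_inv[OF S] a b)
  ultimately show ?thesis by (auto intro: limitin_transform_eventually)
qed

lemma topological_group_limit_unique:
  assumes "topological_group G S" "F \<noteq> bot" "limitin S f l F" "limitin S f m F"
  shows "l = m"
  using assms limitin_Hausdorff_unique[of S f l F m] by (auto simp: topological_group_def)

text \<open>A homomorphism of topological groups that is continuous at the identity is continuous; here
  it is the identity map between two topologies on one group.\<close>

lemma topological_group_eqI:
  assumes S: "topological_group G S" and T: "topological_group G T"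
    and le: "\<And>U. openin S U \<Longrightarrow> openin T U"
    and at_one: "limitin T (\<lambda>x. x) \<one>\<^bsub>G\<^esub> (nhdsin S \<one>\<^bsub>G\<^esub>)"
  shows "S = T"
proof -
  interpret group G using S by (simp add: topological_group_def)
  have tS: "topspace S = carrier G" and tT: "topspace T = carrier G"
    using S T by (auto simp: topological_group_def)
  have "limitin T (\<lambda>x. x) g (nhdsin S g)" if g: "g \<in> carrier G" for g
    unfolding limitin_def
  proof (intro conjI allI impI)
    fix U assume "openin T U \<and> g \<in> U"
    moreover have "limitin T (\<lambda>x. g \<otimes>\<^bsub>G\<^esub> x) (g \<otimes>\<^bsub>G\<^esub> \<one>\<^bsub>G\<^esub>) (nhdsin S \<one>\<^bsub>G\<^esub>)"
      using g by (intro topological_group_limit_mult[OF T] at_one) (simp add: tT)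
    ultimately have "\<forall>\<^sub>F x in nhdsin S \<one>\<^bsub>G\<^esub>. g \<otimes>\<^bsub>G\<^esub> x \<in> U"
      using g by (auto simp: limitin_def)
    then obtain V where V: "openin S V" "\<one>\<^bsub>G\<^esub> \<in> V" "\<And>x. x \<in> V \<Longrightarrow> g \<otimes>\<^bsub>G\<^esub> x \<in> U"
      by (auto simp: eventually_nhdsin tS)
    have "limitin S (\<lambda>x. inv\<^bsub>G\<^esub> g \<otimes>\<^bsub>G\<^esub> x) (inv\<^bsub>G\<^esub> g \<otimes>\<^bsub>G\<^esub> g) (nhdsin S g)"
      using g by (intro topological_group_limit_mult[OF S] limitin_nhdsin_id) (simp_all add: tS)
    then have "\<forall>\<^sub>F x in nhdsin S g. inv\<^bsub>G\<^esub> g \<otimes>\<^bsub>G\<^esub> x \<in> V"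
      using g V by (auto simp: limitin_def)
    moreover have "\<forall>\<^sub>F x in nhdsin S g. x \<in> carrier G"
      using g openin_topspace[of S] by (auto simp: eventually_nhdsin tS)
    ultimately show "\<forall>\<^sub>F x in nhdsin S g. x \<in> U"
    proof eventually_elim
      case (elim x)
      then have "g \<otimes>\<^bsub>G\<^esub> (inv\<^bsub>G\<^esub> g \<otimes>\<^bsub>G\<^esub> x) \<in> U" using V(3) by blast
      then show ?case using g elim by (simp flip: m_assoc)
    qed
  qed (use g in \<open>simp add: tT\<close>)
  then have "openin S U" if "openin T U" for U
    using openin_if_limitin_id[of T S U] that by (simp add: tS tT)
  then show ?thesis using le by (auto simp: topology_eq)
qed

context valued_subfield
begin

text \<open>The initial topology for the functions \<open>\<lambda>x. \<phi> x i\<close>. The usual topology of the matrix group and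
  the coarser one of the negative result are both of this kind, with different coordinates.\<close>

definition generated_topology :: "'b set \<Rightarrow> 'i set \<Rightarrow> ('b \<Rightarrow> 'i \<Rightarrow> 'a) \<Rightarrow> 'b topology" where
  "generated_topology X I \<phi> =
     pullback_topology X (\<lambda>x. restrict (\<phi> x) I) (product_topology (\<lambda>_. mtopology) I)"

lemma limitin_generated_topology:
  assumes \<phi>: "\<And>x i. x \<in> X \<Longrightarrow> i \<in> I \<Longrightarrow> \<phi> x i \<in> K"
  shows "limitin (generated_topology X I \<phi>) f l F \<longleftrightarrow>
    l \<in> X \<and> (\<forall>\<^sub>F x in F. f x \<in> X) \<and> (\<forall>i\<in>I. vtendsto (\<lambda>x. \<phi> (f x) i) (\<phi> l i) F)"
proof -
  have "\<forall>\<^sub>F x in F. \<phi> (f x) i \<in> K" if "\<forall>\<^sub>F x in F. f x \<in> X" "i \<in> I" for i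
    using that(1) by (rule eventually_mono) (use \<phi> that in auto)
  moreover have "\<forall>\<^sub>F x in F. restrict (\<phi> (f x)) I \<in> topspace (product_topology (\<lambda>_. mtopology) I)"
    if "\<forall>\<^sub>F x in F. f x \<in> X"
    using that(1) by (rule eventually_mono) (use \<phi> that in auto)
  ultimately show ?thesis
    unfolding generated_topology_def limitin_pullback_topology limitin_componentwise
    by (auto simp: limitin_mtopology_iff \<phi> simp del: topspace_product_topology)
qed

lemma topspace_generated_topology:
  assumes "\<And>x i. x \<in> X \<Longrightarrow> i \<in> I \<Longrightarrow> \<phi> x i \<in> K"
  shows "topspace (generated_topology X I \<phi>) = X"
  using assms by (auto simp: generated_topology_def topspace_pullback_topology)

text \<open>Continuity of the group operations only has to be checked on coordinates, and there as a statement
  about limits along an arbitrary filter.\<close>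

lemma topological_group_generated_topology:
  fixes G :: "('b, 'm) monoid_scheme" and \<phi> :: "'b \<Rightarrow> 'i \<Rightarrow> 'a"
  assumes G: "group G"
    and \<phi>: "\<And>x i. x \<in> carrier G \<Longrightarrow> i \<in> I \<Longrightarrow> \<phi> x i \<in> K"
    and separates: "\<And>x y. x \<in> carrier G \<Longrightarrow> y \<in> carrier G \<Longrightarrow>
      (\<And>i. i \<in> I \<Longrightarrow> \<phi> x i = \<phi> y i) \<Longrightarrow> x = y"
    and mult: "\<And>F (f :: 'b \<times> 'b \<Rightarrow> 'b) g a b i.
      \<lbrakk>\<forall>\<^sub>F x in F. f x \<in> carrier G; \<forall>\<^sub>F x in F. g x \<in> carrier G; a \<in> carrier G; b \<in> carrier G;
       \<And>i. i \<in> I \<Longrightarrow> vtendsto (\<lambda>x. \<phi> (f x) i) (\<phi> a i) F;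
       \<And>i. i \<in> I \<Longrightarrow> vtendsto (\<lambda>x. \<phi> (g x) i) (\<phi> b i) F; i \<in> I\<rbrakk>
      \<Longrightarrow> vtendsto (\<lambda>x. \<phi> (f x \<otimes>\<^bsub>G\<^esub> g x) i) (\<phi> (a \<otimes>\<^bsub>G\<^esub> b) i) F"
    and inverse: "\<And>F a i.
      \<lbrakk>\<forall>\<^sub>F x in F. x \<in> carrier G; a \<in> carrier G;
       \<And>i. i \<in> I \<Longrightarrow> vtendsto (\<lambda>x. \<phi> x i) (\<phi> a i) F; i \<in> I\<rbrakk>
      \<Longrightarrow> vtendsto (\<lambda>x. \<phi> (inv\<^bsub>G\<^esub> x) i) (\<phi> (inv\<^bsub>G\<^esub> a) i) F"
  shows "topological_group G (generated_topology (carrier G) I \<phi>)"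
proof -
  interpret group G by (rule G)
  define T where "T = generated_topology (carrier G) I \<phi>"
  have top: "topspace T = carrier G"
    unfolding T_def using \<phi> by (rule topspace_generated_topology)
  have lim: "limitin T f l F \<longleftrightarrow> l \<in> carrier G \<and> (\<forall>\<^sub>F x in F. f x \<in> carrier G) \<and>
      (\<forall>i\<in>I. vtendsto (\<lambda>x. \<phi> (f x) i) (\<phi> l i) F)" for f :: "'c \<Rightarrow> 'b" and l F
    unfolding T_def by (rule limitin_generated_topology) (rule \<phi>)
  have "Hausdorff_space T"
    unfolding Hausdorff_space_def
  proof (intro allI impI, elim conjE)
    fix x y assume xy: "x \<in> topspace T" "y \<in> topspace T" "x \<noteq> y"
    then obtain i where i: "i \<in> I" "\<phi> x i \<noteq> \<phi> y i" using separates top by blast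
    have cont: "continuous_map T mtopology (\<lambda>z. \<phi> z i)"
    proof (rule continuous_map_nhdsin)
      fix z assume "z \<in> topspace T"
      then show "limitin mtopology (\<lambda>z. \<phi> z i) (\<phi> z i) (nhdsin T z)"
        using limitin_nhdsin_id[of z T] \<phi> i
        by (auto simp: lim limitin_mtopology_iff top elim!: eventually_mono)
    qed
    have "\<phi> x i \<in> K" "\<phi> y i \<in> K" using \<phi> i xy top by auto
    with i Hausdorff_space_mtopology obtain U V where UV: "openin mtopology U" "openin mtopology V"
      "\<phi> x i \<in> U" "\<phi> y i \<in> V" "disjnt U V"
      unfolding Hausdorff_space_def by (metis topspace_mtopology)
    show "\<exists>U V. openin T U \<and> openin T V \<and> x \<in> U \<and> y \<in> V \<and> disjnt U V"
      using openin_continuous_map_preimage[OF cont UV(1)] openin_continuous_map_preimage[OF cont UV(2)]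
        UV xy
      by (intro exI[of _ "{z \<in> topspace T. \<phi> z i \<in> U}"] exI[of _ "{z \<in> topspace T. \<phi> z i \<in> V}"])
        (auto simp: disjnt_iff)
  qed
  moreover have "continuous_map (prod_topology T T) T (\<lambda>(x, y). x \<otimes>\<^bsub>G\<^esub> y)"
  proof (rule continuous_map_nhdsin)
    fix z assume z: "z \<in> topspace (prod_topology T T)"
    then obtain a b where ab: "z = (a, b)" "a \<in> carrier G" "b \<in> carrier G" by (auto simp: top)
    let ?F = "nhdsin (prod_topology T T) z"
    have f: "limitin T fst a ?F" and g: "limitin T snd b ?F"
      using limitin_nhdsin_id[OF z] unfolding limitin_pairwise by (auto simp: ab o_def)
    have "limitin T (\<lambda>x. fst x \<otimes>\<^bsub>G\<^esub> snd x) (a \<otimes>\<^bsub>G\<^esub> b) ?F"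
      unfolding lim using f[unfolded lim] g[unfolded lim] ab
      by (auto intro: mult elim: eventually_elim2)
    then show "limitin T (\<lambda>(x, y). x \<otimes>\<^bsub>G\<^esub> y) (case z of (x, y) \<Rightarrow> x \<otimes>\<^bsub>G\<^esub> y) ?F"
      by (simp add: ab case_prod_unfold)
  qed
  moreover have "continuous_map T T (\<lambda>x. inv\<^bsub>G\<^esub> x)"
  proof (rule continuous_map_nhdsin)
    fix a assume a: "a \<in> topspace T"
    show "limitin T (\<lambda>x. inv\<^bsub>G\<^esub> x) (inv\<^bsub>G\<^esub> a) (nhdsin T a)"
      unfolding lim using limitin_nhdsin_id[OF a, unfolded lim] a
      by (auto intro: inverse elim: eventually_mono)
  qed
  ultimately show ?thesis
    unfolding topological_group_def T_def[symmetric] using G top by simp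
qed

end

section \<open>Triangular matrices over a subfield\<close>

lemma index_mult_square_mat:
  fixes A B :: "'a::comm_ring_1 mat"
  assumes "A \<in> carrier_mat n n" "B \<in> carrier_mat n n" "i < n" "j < n"
  shows "(A * B) $$ (i, j) = (\<Sum>k<n. A $$ (i, k) * B $$ (k, j))"
  using assms by (auto simp: scalar_prod_def atLeast0LessThan intro!: sum.cong)

lemma ST_plus_sel [simp]: "mult (ST_plus n K) = (*)" "one (ST_plus n K) = 1\<^sub>m n"
  by (simp_all add: ST_plus_def)

lemma in_ST_plus_iff:
  fixes K :: "'a::field set"
  shows "A \<in> carrier (ST_plus n K) \<longleftrightarrow>
    A \<in> carrier_mat n n \<and> (\<forall>i<n. \<forall>j<n. A $$ (i, j) \<in> K) \<and>
    (\<forall>i<n. \<forall>j<i. A $$ (i, j) = 0) \<and> (\<Prod>i<n. A $$ (i, i)) = 1"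
proof -
  have "det A = (\<Prod>i<n. A $$ (i, i))" if "A \<in> carrier_mat n n" "upper_triangular A"
    using det_upper_triangular[OF that(2,1)] that(1) by (simp add: prod_list_diag_prod atLeast0LessThan)
  moreover have "elements_mat A \<subseteq> K \<longleftrightarrow> (\<forall>i<n. \<forall>j<n. A $$ (i, j) \<in> K)" if "A \<in> carrier_mat n n"
    using that elements_matI[OF that] by blast
  moreover have "upper_triangular A \<longleftrightarrow> (\<forall>i<n. \<forall>j<i. A $$ (i, j) = 0)" if "A \<in> carrier_mat n n"
    using that by (simp add: upper_triangular_def)
  ultimately show ?thesis by (auto simp: ST_plus_def)
qed

text \<open>Column by column, the equation \<open>B * A = 1\<close> determines the entries of the inverse below the
  diagonal to be zero.\<close>

lemma upper_triangular_left_inverse: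
  fixes A B :: "'a::field mat"
  assumes A: "A \<in> carrier_mat n n" "\<And>i j. i < n \<Longrightarrow> j < i \<Longrightarrow> A $$ (i, j) = 0"
    and diag: "\<And>i. i < n \<Longrightarrow> A $$ (i, i) \<noteq> 0"
    and B: "B \<in> carrier_mat n n" "B * A = 1\<^sub>m n"
  shows "j < i \<Longrightarrow> i < n \<Longrightarrow> B $$ (i, j) = 0"
proof (induction j rule: less_induct)
  case (less j)
  then have j: "j < n" by simp
  have "0 = (B * A) $$ (i, j)" using B less.prems j by simp
  also have "\<dots> = (\<Sum>k<n. B $$ (i, k) * A $$ (k, j))"
    using index_mult_square_mat[OF B(1) A(1)] less.prems j by simp
  also have "\<dots> = (\<Sum>k<n. if k = j then B $$ (i, j) * A $$ (j, j) else 0)"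
  proof (intro sum.cong refl)
    fix k assume k: "k \<in> {..<n}"
    consider "k < j" | "k = j" | "j < k" by linarith
    then show "B $$ (i, k) * A $$ (k, j) = (if k = j then B $$ (i, j) * A $$ (j, j) else 0)"
      by cases (use less A k in auto)
  qed
  also have "\<dots> = B $$ (i, j) * A $$ (j, j)" using j by simp
  finally show ?case using diag[OF j] by simp
qed

lemma index_diag_mult_triangular:
  fixes A B :: "'a::field mat"
  assumes "A \<in> carrier_mat n n" "\<And>i j. i < n \<Longrightarrow> j < i \<Longrightarrow> A $$ (i, j) = 0"
    and "B \<in> carrier_mat n n" "\<And>i j. i < n \<Longrightarrow> j < i \<Longrightarrow> B $$ (i, j) = 0"
    and "j \<le> i" "i < n"
  shows "(A * B) $$ (i, j) = (if i = j then A $$ (i, i) * B $$ (i, i) else 0)"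
proof -
  have "(A * B) $$ (i, j) = (\<Sum>k<n. A $$ (i, k) * B $$ (k, j))"
    using assms by (intro index_mult_square_mat) auto
  also have "\<dots> = (\<Sum>k<n. if k = i then (if i = j then A $$ (i, i) * B $$ (i, i) else 0) else 0)"
  proof (intro sum.cong refl)
    fix k assume k: "k \<in> {..<n}"
    consider "k < i" | "k = i" | "i < k" by linarith
    then show "A $$ (i, k) * B $$ (k, j) =
        (if k = i then (if i = j then A $$ (i, i) * B $$ (i, i) else 0) else 0)"
      by cases (use assms k in auto)
  qed
  finally show ?thesis using assms by simp
qed

lemma cofactor_smult:
  fixes A :: "'a::comm_ring_1 mat"
  assumes "A \<in> carrier_mat n n"
  shows "cofactor (c \<cdot>\<^sub>m A) i j = c ^ (n - 1) * cofactor A i j"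
proof -
  have "mat_delete (c \<cdot>\<^sub>m A) i j = c \<cdot>\<^sub>m mat_delete A i j"
    using assms by (auto simp: mat_delete_def)
  then show ?thesis
    using assms by (simp add: cofactor_def algebra_simps)
qed

text \<open>A cofactor is a polynomial in the entries; written out, it inherits closure and continuity from the
  field operations.\<close>

lemma cofactor_as_sum:
  fixes A :: "'a::comm_ring_1 mat"
  assumes "A \<in> carrier_mat n n"
  shows "cofactor A i j = (-1) ^ (i + j) * (\<Sum>p\<in>{p. p permutes {0..<n - 1}}.
    signof p * (\<Prod>k = 0..<n - 1. A $$ (if k < i then k else Suc k, if p k < j then p k else Suc (p k))))"
proof -
  have "mat_delete A i j \<in> carrier_mat (n - 1) (n - 1)"
    using mat_delete_carrier[OF assms] .
  then have "det (mat_delete A i j) = (\<Sum>p\<in>{p. p permutes {0..<n - 1}}.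
    signof p * (\<Prod>k = 0..<n - 1. mat_delete A i j $$ (k, p k)))"
    by (rule det_def')
  also have "\<dots> = (\<Sum>p\<in>{p. p permutes {0..<n - 1}}.
    signof p * (\<Prod>k = 0..<n - 1. A $$ (if k < i then k else Suc k, if p k < j then p k else Suc (p k))))"
  proof (intro sum.cong prod.cong refl arg_cong2[where f = "(*)"])
    fix p k assume "p \<in> {p. p permutes {0..<n - 1}}" "k \<in> {0..<n - 1}"
    then have "p k < n - 1" "k < n - 1" using permutes_in_image[of p "{0..<n-1}" k] by auto
    then show "mat_delete A i j $$ (k, p k) =
        A $$ (if k < i then k else Suc k, if p k < j then p k else Suc (p k))"
      using assms by (auto simp: mat_delete_def)
  qed
  finally show ?thesis by (simp add: cofactor_def)
qed

context valued_subfield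
begin

lemma signof_closed: "(signof p :: 'a) \<in> K"
  by (cases p rule: sign_cases) (auto simp: closed)

lemma cofactor_closed:
  assumes A: "A \<in> carrier_mat n n" "\<And>i j. i < n \<Longrightarrow> j < n \<Longrightarrow> A $$ (i, j) \<in> K" and ij: "i < n" "j < n"
  shows "cofactor A i j \<in> K"
  unfolding cofactor_as_sum[OF A(1)]
proof (intro mult_closed power_closed sum_closed prod_closed signof_closed minus_closed one_mem)
  fix p k assume "p \<in> {p. p permutes {0..<n - 1}}" "k \<in> {0..<n - 1}"
  then have "p k < n - 1" "k < n - 1" using permutes_in_image[of p "{0..<n-1}" k] by auto
  then show "A $$ (if k < i then k else Suc k, if p k < j then p k else Suc (p k)) \<in> K"
    using A(2) by auto
qed

lemma vtendsto_cofactor: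
  assumes A: "\<forall>\<^sub>F x in F. A x \<in> carrier_mat n n" and B: "B \<in> carrier_mat n n"
    and lim: "\<And>i j. i < n \<Longrightarrow> j < n \<Longrightarrow> vtendsto (\<lambda>x. A x $$ (i, j)) (B $$ (i, j)) F"
  shows "vtendsto (\<lambda>x. cofactor (A x) i j) (cofactor B i j) F"
proof -
  let ?c = "\<lambda>A. (-1) ^ (i + j) * (\<Sum>p\<in>{p. p permutes {0..<n - 1}}. signof p *
    (\<Prod>k = 0..<n - 1. A $$ (if k < i then k else Suc k, if p k < j then p k else Suc (p k))))"
  have "vtendsto (\<lambda>x. ?c (A x)) (?c B) F"
  proof (intro vtendsto_mult vtendsto_sum vtendsto_prod vtendsto_const)
    fix p k assume "p \<in> {p. p permutes {0..<n - 1}}" "k \<in> {0..<n - 1}"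
    then have "p k < n - 1" "k < n - 1" using permutes_in_image[of p "{0..<n-1}" k] by auto
    then show "vtendsto (\<lambda>x. A x $$ (if k < i then k else Suc k, if p k < j then p k else Suc (p k)))
        (B $$ (if k < i then k else Suc k, if p k < j then p k else Suc (p k))) F"
      by (intro lim) auto
  qed
  moreover have "\<forall>\<^sub>F x in F. cofactor (A x) i j = ?c (A x)"
    using A by (rule eventually_mono) (rule cofactor_as_sum)
  ultimately show ?thesis
    using cofactor_as_sum[OF B, of i j] by (simp add: vtendsto_cong)
qed

end

text \<open>The size is at least two, and \<open>l\<close> is the last index. Both are kept as variables, because the simplifier
  would otherwise peel off the last term of every sum over the indices.\<close>

locale triangular_group = valued_subfield K v for K :: "'a::field set" and v +
  fixes n l :: nat
  assumes n_eq: "n = Suc l" and l_pos: "0 < l"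
begin

abbreviation G :: "'a mat monoid" where "G \<equiv> ST_plus n K"

abbreviation \<tau> :: "'a mat topology" where "\<tau> \<equiv> ST_plus_topology n mtopology"

lemma l_less [simp]: "l < n" and n_pos [simp]: "0 < n" and l_neq_0 [simp]: "l \<noteq> 0" "0 \<noteq> l"
  using n_eq l_pos by auto

lemma less_n_cases: "i < n \<Longrightarrow> i < l \<or> i = l"
  using n_eq by auto

lemma GD:
  assumes "A \<in> carrier G"
  shows "A \<in> carrier_mat n n" "\<And>i j. i < n \<Longrightarrow> j < n \<Longrightarrow> A $$ (i, j) \<in> K"
    "\<And>i j. i < n \<Longrightarrow> j < i \<Longrightarrow> A $$ (i, j) = 0" "(\<Prod>i<n. A $$ (i, i)) = 1"
  using assms by (auto simp: in_ST_plus_iff)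

lemma diag_neq_0: "A \<in> carrier G \<Longrightarrow> i < n \<Longrightarrow> A $$ (i, i) \<noteq> 0"
  using GD(4)[of A] by (metis finite_lessThan lessThan_iff prod_zero_iff zero_neq_one)

lemma det_eq_1: "A \<in> carrier G \<Longrightarrow> det A = 1"
  by (simp add: ST_plus_def)

lemma mult_in_G:
  assumes A: "A \<in> carrier G" and B: "B \<in> carrier G"
  shows "A * B \<in> carrier G"
  unfolding in_ST_plus_iff
proof (intro conjI allI impI)
  note a = GD[OF A] and b = GD[OF B]
  show "A * B \<in> carrier_mat n n" using a b by simp
  show "(A * B) $$ (i, j) \<in> K" if "i < n" "j < n" for i j
    using that a b by (subst index_mult_square_mat[of _ n]) (auto intro!: sum_closed mult_closed)
  show "(A * B) $$ (i, j) = 0" if "i < n" "j < i" for i j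
    using that a b by (simp add: index_diag_mult_triangular[of _ n] del: index_mult_mat)
  show "(\<Prod>i<n. (A * B) $$ (i, i)) = 1"
    using a b by (simp add: index_diag_mult_triangular[of _ n] prod.distrib del: index_mult_mat)
qed

lemma one_in_G: "1\<^sub>m n \<in> carrier G"
  by (simp add: in_ST_plus_iff closed)

lemma adj_mat_in_G:
  assumes A: "A \<in> carrier G"
  shows "adj_mat A \<in> carrier G" "adj_mat A * A = 1\<^sub>m n" "A * adj_mat A = 1\<^sub>m n"
proof -
  note a = GD[OF A] and adj = adj_mat[OF GD(1)[OF A]]
  show 1: "adj_mat A * A = 1\<^sub>m n" and 2: "A * adj_mat A = 1\<^sub>m n"
    using adj det_eq_1[OF A] by auto
  have zero: "adj_mat A $$ (i, j) = 0" if "i < n" "j < i" for i j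
    using upper_triangular_left_inverse[OF a(1,3) diag_neq_0[OF A] adj(1) 1] that by blast
  have diag: "adj_mat A $$ (i, i) * A $$ (i, i) = 1" if "i < n" for i
    using index_diag_mult_triangular[OF adj(1) zero a(1,3), of i i] that 1 by simp
  show "adj_mat A \<in> carrier G"
    unfolding in_ST_plus_iff
  proof (intro conjI allI impI)
    show "adj_mat A $$ (i, j) \<in> K" if "i < n" "j < n" for i j
      using a that by (simp add: adj_mat_def cofactor_closed)
    have "(\<Prod>i<n. adj_mat A $$ (i, i)) * (\<Prod>i<n. A $$ (i, i)) = 1"
      by (simp add: diag flip: prod.distrib)
    then show "(\<Prod>i<n. adj_mat A $$ (i, i)) = 1" using a(4) by simp
  qed (use adj zero in auto)
qed

lemma group_G: "group G"
proof (rule groupI)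
  show "\<exists>B\<in>carrier G. B \<otimes>\<^bsub>G\<^esub> A = \<one>\<^bsub>G\<^esub>" if "A \<in> carrier G" for A
    using adj_mat_in_G[OF that] by auto
qed (auto simp: mult_in_G one_in_G dest!: GD(1))

sublocale group G by (rule group_G)

lemma inv_eq_adj_mat: "A \<in> carrier G \<Longrightarrow> inv\<^bsub>G\<^esub> A = adj_mat A"
  using adj_mat_in_G[of A] inv_equality[of "adj_mat A" A] by simp

lemma \<tau>_eq: "\<tau> = generated_topology (carrier G) ({..<n} \<times> {..<n}) (\<lambda>A ij. A $$ ij)"
  by (simp add: ST_plus_topology_def generated_topology_def mat_entries_def[abs_def] topspace_mtopology)

lemma limitin_\<tau>:
  "limitin \<tau> f A F \<longleftrightarrow> A \<in> carrier G \<and> (\<forall>\<^sub>F x in F. f x \<in> carrier G) \<and>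
    (\<forall>i<n. \<forall>j<n. vtendsto (\<lambda>x. f x $$ (i, j)) (A $$ (i, j)) F)"
  unfolding \<tau>_eq by (subst limitin_generated_topology) (auto simp: GD)

lemma topological_group_\<tau>: "topological_group G \<tau>"
  unfolding \<tau>_eq
proof (rule topological_group_generated_topology)
  show "group G" by (rule group_G)
next
  fix A B assume "A \<in> carrier G" "B \<in> carrier G" "\<And>ij. ij \<in> {..<n} \<times> {..<n} \<Longrightarrow> A $$ ij = B $$ ij"
  then show "A = B" by (intro eq_matI) (auto dest!: GD(1))
next
  fix F and f g :: "'a mat \<times> 'a mat \<Rightarrow> 'a mat" and A B and ij :: "nat \<times> nat"
  assume f: "\<forall>\<^sub>F x in F. f x \<in> carrier G" and g: "\<forall>\<^sub>F x in F. g x \<in> carrier G"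
    and AB: "A \<in> carrier G" "B \<in> carrier G"
    and lim: "\<And>ij. ij \<in> {..<n} \<times> {..<n} \<Longrightarrow> vtendsto (\<lambda>x. f x $$ ij) (A $$ ij) F"
      "\<And>ij. ij \<in> {..<n} \<times> {..<n} \<Longrightarrow> vtendsto (\<lambda>x. g x $$ ij) (B $$ ij) F"
    and ij: "ij \<in> {..<n} \<times> {..<n}"
  obtain i j where [simp]: "ij = (i, j)" "i < n" "j < n" using ij by auto
  have "vtendsto (\<lambda>x. \<Sum>k<n. f x $$ (i, k) * g x $$ (k, j)) (\<Sum>k<n. A $$ (i, k) * B $$ (k, j)) F"
    by (intro vtendsto_sum vtendsto_mult lim) auto
  moreover have "\<forall>\<^sub>F x in F. (f x * g x) $$ (i, j) = (\<Sum>k<n. f x $$ (i, k) * g x $$ (k, j))"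
    using f g by eventually_elim (auto intro!: index_mult_square_mat dest: GD(1))
  moreover have "(A * B) $$ (i, j) = (\<Sum>k<n. A $$ (i, k) * B $$ (k, j))"
    using AB by (intro index_mult_square_mat) (auto dest: GD(1))
  ultimately show "vtendsto (\<lambda>x. (f x \<otimes>\<^bsub>G\<^esub> g x) $$ ij) ((A \<otimes>\<^bsub>G\<^esub> B) $$ ij) F"
    by (simp add: vtendsto_cong del: index_mult_mat)
next
  fix F :: "'a mat filter" and A and ij :: "nat \<times> nat"
  assume F: "\<forall>\<^sub>F x in F. x \<in> carrier G" and A: "A \<in> carrier G"
    and lim: "\<And>ij. ij \<in> {..<n} \<times> {..<n} \<Longrightarrow> vtendsto (\<lambda>x. x $$ ij) (A $$ ij) F"
    and ij: "ij \<in> {..<n} \<times> {..<n}"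
  obtain i j where [simp]: "ij = (i, j)" "i < n" "j < n" using ij by auto
  have "vtendsto (\<lambda>x. cofactor x j i) (cofactor A j i) F"
    using GD(1)[OF A] lim F by (intro vtendsto_cofactor[where n = n]) (auto elim: eventually_mono dest: GD(1))
  moreover have "(inv\<^bsub>G\<^esub> B) $$ (i, j) = cofactor B j i" if "B \<in> carrier G" for B
    using that GD(1)[OF that] by (simp add: inv_eq_adj_mat adj_mat_def)
  then have "\<forall>\<^sub>F x in F. (inv\<^bsub>G\<^esub> x) $$ (i, j) = cofactor x j i" "(inv\<^bsub>G\<^esub> A) $$ (i, j) = cofactor A j i"
    using F A by (auto elim: eventually_mono)
  ultimately show "vtendsto (\<lambda>x. (inv\<^bsub>G\<^esub> x) $$ ij) ((inv\<^bsub>G\<^esub> A) $$ ij) F"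
    by (simp add: vtendsto_cong)
qed (auto simp: GD)

end

section \<open>A coarser topology when roots of unity are missing\<close>

context triangular_group
begin

text \<open>The coordinate \<open>None\<close> remembers the \<open>q\<close>-th power of the first entry, and the coordinates
  \<open>Some (i, j)\<close> remember the matrix up to a scalar. Together they determine the matrix up to a scalar
  that is a \<open>q\<close>-th root of unity.\<close>

definition projective_coord :: "nat \<Rightarrow> 'a mat \<Rightarrow> (nat \<times> nat) option \<Rightarrow> 'a" where
  "projective_coord q A c = (case c of None \<Rightarrow> (A $$ (0, 0)) ^ q | Some ij \<Rightarrow> A $$ ij / A $$ (0, 0))"

definition projective_topology :: "nat \<Rightarrow> 'a mat topology" where
  "projective_topology q =
     generated_topology (carrier G) (insert None (Some ` ({..<n} \<times> {..<n}))) (projective_coord q)"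

lemma projective_coord_simps [simp]:
  "projective_coord q A None = (A $$ (0, 0)) ^ q"
  "projective_coord q A (Some ij) = A $$ ij / A $$ (0, 0)"
  by (simp_all add: projective_coord_def)

lemma projective_coord_closed:
  "A \<in> carrier G \<Longrightarrow> c \<in> insert None (Some ` ({..<n} \<times> {..<n})) \<Longrightarrow> projective_coord q A c \<in> K"
  by (auto simp: GD intro!: closed)

lemma limitin_projective_topology:
  "limitin (projective_topology q) f A F \<longleftrightarrow> A \<in> carrier G \<and> (\<forall>\<^sub>F x in F. f x \<in> carrier G) \<and>
    vtendsto (\<lambda>x. (f x $$ (0, 0)) ^ q) ((A $$ (0, 0)) ^ q) F \<and>
    (\<forall>i<n. \<forall>j<n. vtendsto (\<lambda>x. f x $$ (i, j) / f x $$ (0, 0)) (A $$ (i, j) / A $$ (0, 0)) F)"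
  unfolding projective_topology_def
  by (subst limitin_generated_topology) (auto simp: projective_coord_closed)

text \<open>Cofactors are homogeneous, so the ratios of entries of the inverse depend only on the ratios of
  entries of the matrix.\<close>

lemma inv_ratio_eq_cofactor_ratio:
  assumes A: "A \<in> carrier G" and ij: "i < n" "j < n" and c: "c \<noteq> 0"
  shows "(inv\<^bsub>G\<^esub> A) $$ (i, j) / (inv\<^bsub>G\<^esub> A) $$ (0, 0) =
    cofactor (c \<cdot>\<^sub>m A) j i / cofactor (c \<cdot>\<^sub>m A) 0 0"
  using GD(1)[OF A] ij c
  by (simp add: inv_eq_adj_mat[OF A] adj_mat_def cofactor_smult[OF GD(1)[OF A]])

lemma inv_diag:
  assumes A: "A \<in> carrier G"
  shows "(inv\<^bsub>G\<^esub> A) $$ (0, 0) = inverse (A $$ (0, 0))"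
proof -
  have i: "inv\<^bsub>G\<^esub> A \<in> carrier G" using A by (rule inv_closed)
  have "inv\<^bsub>G\<^esub> A * A = 1\<^sub>m n" using l_inv[OF A] by simp
  then have "(inv\<^bsub>G\<^esub> A) $$ (0, 0) * A $$ (0, 0) = 1"
    using index_diag_mult_triangular[OF GD(1,3)[OF i] GD(1,3)[OF A], of 0 0] by simp
  then have "A $$ (0, 0) * (inv\<^bsub>G\<^esub> A) $$ (0, 0) = 1" by (simp add: mult.commute)
  then show ?thesis by (rule inverse_unique[symmetric])
qed

text \<open>Modulo scalars the multiplication and the inverse are well defined and continuous, and \<open>A (0, 0) ^ q\<close> is
  a character of the triangular group. The absence of \<open>q\<close>-th roots of unity gives the Hausdorff
  property.\<close>

lemma topological_group_projective_topology:
  assumes q: "0 < q" and roots: "\<And>x. x \<in> K \<Longrightarrow> x ^ q = 1 \<Longrightarrow> x = 1"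
  shows "topological_group G (projective_topology q)"
  unfolding projective_topology_def
proof (rule topological_group_generated_topology)
  let ?I = "insert None (Some ` ({..<n} \<times> {..<n}))"
  show "group G" by (rule group_G)
  show "projective_coord q A c \<in> K" if "A \<in> carrier G" "c \<in> ?I" for A c
    using that by (rule projective_coord_closed)
next
  let ?I = "insert None (Some ` ({..<n} \<times> {..<n}))"
  fix A B assume A: "A \<in> carrier G" and B: "B \<in> carrier G"
    and eq: "\<And>c. c \<in> ?I \<Longrightarrow> projective_coord q A c = projective_coord q B c"
  note nz = diag_neq_0[OF A n_pos] diag_neq_0[OF B n_pos]
  have "(A $$ (0, 0) / B $$ (0, 0)) ^ q = 1"
    using eq[of None] nz by (simp add: power_divide)
  then have "A $$ (0, 0) / B $$ (0, 0) = 1"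
    by (rule roots[rotated]) (use A B in \<open>auto simp: GD intro!: closed\<close>)
  then have "A $$ (0, 0) = B $$ (0, 0)" using nz by simp
  then have "A $$ (i, j) = B $$ (i, j)" if "i < n" "j < n" for i j
    using eq[of "Some (i, j)"] that nz by simp
  then show "A = B" using GD(1)[OF A] GD(1)[OF B] by (intro eq_matI) auto
next
  let ?I = "insert None (Some ` ({..<n} \<times> {..<n}))"
  fix F and f g :: "'a mat \<times> 'a mat \<Rightarrow> 'a mat" and A B and c
  assume f: "\<forall>\<^sub>F x in F. f x \<in> carrier G" and g: "\<forall>\<^sub>F x in F. g x \<in> carrier G"
    and A: "A \<in> carrier G" and B: "B \<in> carrier G"
    and limf: "\<And>c. c \<in> ?I \<Longrightarrow> vtendsto (\<lambda>x. projective_coord q (f x) c) (projective_coord q A c) F"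
    and limg: "\<And>c. c \<in> ?I \<Longrightarrow> vtendsto (\<lambda>x. projective_coord q (g x) c) (projective_coord q B c) F"
    and c: "c \<in> ?I"
  have diag: "(C * D) $$ (0, 0) = C $$ (0, 0) * D $$ (0, 0)" if "C \<in> carrier G" "D \<in> carrier G" for C D
    using index_diag_mult_triangular[OF GD(1,3)[OF that(1)] GD(1,3)[OF that(2)], of 0 0] by simp
  show "vtendsto (\<lambda>x. projective_coord q (f x \<otimes>\<^bsub>G\<^esub> g x) c) (projective_coord q (A \<otimes>\<^bsub>G\<^esub> B) c) F"
  proof (cases c)
    case None
    have "vtendsto (\<lambda>x. (f x $$ (0, 0)) ^ q * (g x $$ (0, 0)) ^ q)
        ((A $$ (0, 0)) ^ q * (B $$ (0, 0)) ^ q) F"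
      using limf[of None] limg[of None] by (intro vtendsto_mult) auto
    moreover have "\<forall>\<^sub>F x in F. (f x $$ (0, 0)) ^ q * (g x $$ (0, 0)) ^ q = ((f x * g x) $$ (0, 0)) ^ q"
      using f g by eventually_elim (simp add: diag power_mult_distrib del: index_mult_mat(1))
    ultimately have "vtendsto (\<lambda>x. ((f x * g x) $$ (0, 0)) ^ q)
        ((A $$ (0, 0)) ^ q * (B $$ (0, 0)) ^ q) F"
      by (rule vtendsto_transform_eventually)
    then show ?thesis
      using diag[OF A B] by (simp add: None power_mult_distrib del: index_mult_mat(1))
  next
    case (Some ij)
    with c obtain i j where ij: "c = Some (i, j)" "i < n" "j < n" by auto
    have eq: "(C * D) $$ (i, j) / (C * D) $$ (0, 0) =
        (\<Sum>k<n. (C $$ (i, k) / C $$ (0, 0)) * (D $$ (k, j) / D $$ (0, 0)))"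
      if "C \<in> carrier G" "D \<in> carrier G" for C D
      using that ij index_mult_square_mat[OF GD(1)[OF that(1)] GD(1)[OF that(2)], of i j]
      by (simp add: diag sum_divide_distrib del: index_mult_mat(1))
    have "vtendsto (\<lambda>x. \<Sum>k<n. (f x $$ (i, k) / f x $$ (0, 0)) * (g x $$ (k, j) / g x $$ (0, 0)))
        (\<Sum>k<n. (A $$ (i, k) / A $$ (0, 0)) * (B $$ (k, j) / B $$ (0, 0))) F"
    proof (intro vtendsto_sum vtendsto_mult)
      fix k assume "k \<in> {..<n}"
      then show "vtendsto (\<lambda>x. f x $$ (i, k) / f x $$ (0, 0)) (A $$ (i, k) / A $$ (0, 0)) F"
        "vtendsto (\<lambda>x. g x $$ (k, j) / g x $$ (0, 0)) (B $$ (k, j) / B $$ (0, 0)) F"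
        using limf[of "Some (i, k)"] limg[of "Some (k, j)"] ij by auto
    qed
    moreover have "\<forall>\<^sub>F x in F. (\<Sum>k<n. (f x $$ (i, k) / f x $$ (0, 0)) * (g x $$ (k, j) / g x $$ (0, 0))) =
        (f x * g x) $$ (i, j) / (f x * g x) $$ (0, 0)"
      using f g by eventually_elim (rule eq[symmetric])
    ultimately have "vtendsto (\<lambda>x. (f x * g x) $$ (i, j) / (f x * g x) $$ (0, 0))
        (\<Sum>k<n. (A $$ (i, k) / A $$ (0, 0)) * (B $$ (k, j) / B $$ (0, 0))) F"
      by (rule vtendsto_transform_eventually)
    then show ?thesis using eq[OF A B] ij by (simp del: index_mult_mat(1))
  qed
next
  let ?I = "insert None (Some ` ({..<n} \<times> {..<n}))"
  fix F and A :: "'a mat" and c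
  assume F: "\<forall>\<^sub>F x in F. x \<in> carrier G" and A: "A \<in> carrier G"
    and lim: "\<And>c. c \<in> ?I \<Longrightarrow> vtendsto (\<lambda>x. projective_coord q x c) (projective_coord q A c) F"
    and c: "c \<in> ?I"
  show "vtendsto (\<lambda>x. projective_coord q (inv\<^bsub>G\<^esub> x) c) (projective_coord q (inv\<^bsub>G\<^esub> A) c) F"
  proof (cases c)
    case None
    have "vtendsto (\<lambda>x. inverse ((x $$ (0, 0)) ^ q)) (inverse ((A $$ (0, 0)) ^ q)) F"
      using lim[of None] diag_neq_0[OF A n_pos] by (intro vtendsto_inverse) auto
    moreover have "\<forall>\<^sub>F x in F. inverse ((x $$ (0, 0)) ^ q) = ((inv\<^bsub>G\<^esub> x) $$ (0, 0)) ^ q"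
      using F by eventually_elim (simp add: inv_diag power_inverse)
    ultimately have "vtendsto (\<lambda>x. ((inv\<^bsub>G\<^esub> x) $$ (0, 0)) ^ q) (inverse ((A $$ (0, 0)) ^ q)) F"
      by (rule vtendsto_transform_eventually)
    then show ?thesis using A by (simp add: None inv_diag power_inverse)
  next
    case (Some ij)
    with c obtain i j where ij: "c = Some (i, j)" "i < n" "j < n" by auto
    let ?N = "\<lambda>A. inverse (A $$ (0, 0)) \<cdot>\<^sub>m A"
    have cof: "vtendsto (\<lambda>x. cofactor (?N x) a b) (cofactor (?N A) a b) F" for a b
    proof (rule vtendsto_cofactor)
      show "\<forall>\<^sub>F x in F. ?N x \<in> carrier_mat n n" using F by eventually_elim (auto dest: GD(1))
      show "?N A \<in> carrier_mat n n" using GD(1)[OF A] by simp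
      fix i j assume ij: "i < n" "j < n"
      have "vtendsto (\<lambda>x. x $$ (i, j) / x $$ (0, 0)) (A $$ (i, j) / A $$ (0, 0)) F"
        using lim[of "Some (i, j)"] ij by simp
      moreover have "\<forall>\<^sub>F x in F. x $$ (i, j) / x $$ (0, 0) = ?N x $$ (i, j)"
        using F
      proof eventually_elim
        case (elim x)
        then show ?case using ij GD(1)[OF elim] by (simp add: divide_inverse mult.commute)
      qed
      ultimately have "vtendsto (\<lambda>x. ?N x $$ (i, j)) (A $$ (i, j) / A $$ (0, 0)) F"
        by (rule vtendsto_transform_eventually)
      then show "vtendsto (\<lambda>x. ?N x $$ (i, j)) (?N A $$ (i, j)) F"
        using ij GD(1)[OF A] by (simp add: divide_inverse mult.commute)
    qed
    have nz: "inverse (B $$ (0, 0)) \<noteq> 0" if "B \<in> carrier G" for B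
      using diag_neq_0[OF that n_pos] by simp
    have "cofactor A 0 0 = (inv\<^bsub>G\<^esub> A) $$ (0, 0)"
      using GD(1)[OF A] by (simp add: inv_eq_adj_mat[OF A] adj_mat_def)
    then have "cofactor A 0 0 \<noteq> 0" using inv_diag[OF A] nz[OF A] by simp
    then have "cofactor (?N A) 0 0 \<noteq> 0"
      using nz[OF A] by (simp add: cofactor_smult[OF GD(1)[OF A]])
    then have "vtendsto (\<lambda>x. cofactor (?N x) j i / cofactor (?N x) 0 0)
        (cofactor (?N A) j i / cofactor (?N A) 0 0) F"
      by (intro vtendsto_divide cof)
    moreover have "\<forall>\<^sub>F x in F. cofactor (?N x) j i / cofactor (?N x) 0 0 =
        (inv\<^bsub>G\<^esub> x) $$ (i, j) / (inv\<^bsub>G\<^esub> x) $$ (0, 0)"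
      using F
    proof eventually_elim
      case (elim x)
      from inv_ratio_eq_cofactor_ratio[OF elim ij(2,3) nz[OF elim]] show ?case by (rule sym)
    qed
    ultimately have "vtendsto (\<lambda>x. (inv\<^bsub>G\<^esub> x) $$ (i, j) / (inv\<^bsub>G\<^esub> x) $$ (0, 0))
        (cofactor (?N A) j i / cofactor (?N A) 0 0) F"
      by (rule vtendsto_transform_eventually)
    then show ?thesis
      using inv_ratio_eq_cofactor_ratio[OF A ij(2,3) nz[OF A]] ij by simp
  qed
qed

lemma projective_topology_coarser:
  assumes "openin (projective_topology q) U"
  shows "openin \<tau> U"
proof (rule openin_if_limitin_id[OF _ _ assms])
  have tt: "topspace \<tau> = carrier G"
    using topological_group_\<tau> by (simp add: topological_group_def)
  show "topspace (projective_topology q) = topspace \<tau>"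
    unfolding tt projective_topology_def
    by (rule topspace_generated_topology) (rule projective_coord_closed)
  fix A assume A: "A \<in> topspace \<tau>"
  then show "limitin (projective_topology q) (\<lambda>x. x) A (nhdsin \<tau> A)"
    using limitin_nhdsin_id[OF A] diag_neq_0[of A 0]
    unfolding limitin_projective_topology limitin_\<tau>
    by (auto intro!: vtendsto_power vtendsto_divide simp: tt)
qed

text \<open>The diagonal matrices with entries \<open>x k, ..., x k, x k ^ (- l)\<close> converge to the identity in the
  projective topology: the last ratio is \<open>x k ^ (- n)\<close>, and \<open>n\<close> is a multiple of \<open>q\<close>. In the original topology
  they would converge only if \<open>x k\<close> tended to \<open>1\<close>.\<close>

lemma not_minimal_if_missing_roots:
  assumes q: "0 < q" "q dvd n" and roots: "\<And>x. x \<in> K \<Longrightarrow> x ^ q = 1 \<Longrightarrow> x = 1"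
    and x: "\<And>k. x k \<in> K" "vtendsto (\<lambda>k. x k ^ q) 1 sequentially" "\<not> vtendsto x 1 sequentially"
  shows "\<not> minimal_topological_group G \<tau>"
proof
  assume "minimal_topological_group G \<tau>"
  then have "\<forall>S. topological_group G S \<and> (\<forall>U. openin S U \<longrightarrow> openin \<tau> U) \<longrightarrow> S = \<tau>"
    by (simp add: minimal_topological_group_iff_coarser)
  then have eq: "projective_topology q = \<tau>"
    by (simp add: topological_group_projective_topology[OF q(1) roots] projective_topology_coarser)
  define A where "A k = mat n n (\<lambda>(i, j). if i = j then (if i = l then inverse (x k ^ l) else x k) else 0)" for k
  have "((\<lambda>k. v (x k ^ q)) \<longlongrightarrow> 1) sequentially" using vtendsto_v[OF x(2)] by simp
  then have "\<forall>\<^sub>F k in sequentially. 0 < v (x k ^ q)" by (simp add: order_tendstoD)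
  then have nz: "\<forall>\<^sub>F k in sequentially. x k \<noteq> 0"
    by eventually_elim (use q in \<open>auto simp: zero_power\<close>)
  have "limitin (projective_topology q) A (1\<^sub>m n) sequentially"
    unfolding limitin_projective_topology
  proof (intro conjI allI impI one_in_G)
    show "\<forall>\<^sub>F k in sequentially. A k \<in> carrier G"
      using nz
    proof eventually_elim
      case (elim k)
      have "(\<Prod>i<n. A k $$ (i, i)) = (\<Prod>i<l. A k $$ (i, i)) * A k $$ (l, l)" by (simp add: n_eq)
      also have "(\<Prod>i<l. A k $$ (i, i)) = (\<Prod>i<l. x k)"
        by (intro prod.cong refl) (auto simp: A_def n_eq)
      finally have "(\<Prod>i<n. A k $$ (i, i)) = 1" using elim by (simp add: A_def)
      moreover have "\<forall>i<n. \<forall>j<n. A k $$ (i, j) \<in> K" "\<forall>i<n. \<forall>j<i. A k $$ (i, j) = 0"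
        "A k \<in> carrier_mat n n"
        using x(1) by (auto simp: A_def intro!: closed)
      ultimately show ?case by (simp add: in_ST_plus_iff)
    qed
    show "vtendsto (\<lambda>k. (A k $$ (0, 0)) ^ q) ((1\<^sub>m n $$ (0, 0)) ^ q) sequentially"
      using x(2) by (simp add: A_def)
    fix i j assume ij: "i < n" "j < n"
    obtain m where m: "n = q * m" using q(2) by blast
    have "vtendsto (\<lambda>k. inverse ((x k ^ q) ^ m)) (inverse (1 ^ m)) sequentially"
      by (intro vtendsto_inverse vtendsto_power x) auto
    then have last: "vtendsto (\<lambda>k. inverse (x k ^ n)) 1 sequentially"
      by (simp add: m power_mult)
    have "vtendsto (\<lambda>k. if i = j then if i = l then inverse (x k ^ n) else 1 else 0)
        (if i = j then 1 else 0) sequentially"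
      using last by (cases "i = j"; cases "i = l") auto
    moreover have "\<forall>\<^sub>F k in sequentially. (if i = j then if i = l then inverse (x k ^ n) else 1 else 0) =
        A k $$ (i, j) / A k $$ (0, 0)"
      using nz by eventually_elim (use ij in \<open>simp add: A_def n_eq divide_inverse\<close>)
    ultimately have "vtendsto (\<lambda>k. A k $$ (i, j) / A k $$ (0, 0)) (if i = j then 1 else 0) sequentially"
      by (rule vtendsto_transform_eventually)
    then show "vtendsto (\<lambda>k. A k $$ (i, j) / A k $$ (0, 0)) (1\<^sub>m n $$ (i, j) / 1\<^sub>m n $$ (0, 0)) sequentially"
      using ij by simp
  qed
  then have "\<forall>i<n. \<forall>j<n. vtendsto (\<lambda>k. A k $$ (i, j)) (1\<^sub>m n $$ (i, j)) sequentially"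
    unfolding eq limitin_\<tau> by (elim conjE)
  from this[rule_format, OF n_pos n_pos] show False using x(3) by (simp add: A_def)
qed

end

section \<open>Transvections and their commutators\<close>

context triangular_group
begin

lemma less_l_imp_less_n [simp]: "i < l \<Longrightarrow> i < n"
  using n_eq by simp

definition corner :: "'a \<Rightarrow> 'a mat" where
  "corner x = mat n n (\<lambda>(i, j). (if i = j then 1 else 0) + (if i = 0 \<and> j = l then x else 0))"

definition col_transvection :: "(nat \<Rightarrow> 'a) \<Rightarrow> 'a mat" where
  "col_transvection u = mat n n (\<lambda>(i, j). (if i = j then 1 else 0) + (if i < l \<and> j = l then u i else 0))"

definition row_transvection :: "(nat \<Rightarrow> 'a) \<Rightarrow> 'a mat" where
  "row_transvection w = mat n n (\<lambda>(i, j). (if i = j then 1 else 0) + (if i = 0 \<and> 0 < j then w j else 0))"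

definition torus_entry :: "'a \<Rightarrow> nat \<Rightarrow> 'a" where
  "torus_entry t i = (if i = 0 then t else 1) * (if i = l then inverse t else 1)"

definition torus :: "'a \<Rightarrow> 'a mat" where
  "torus t = mat n n (\<lambda>(i, j). if i = j then torus_entry t i else 0)"

text \<open>Used as the coordinate function of an elementary column or row transvection.\<close>

definition basis_fun :: "nat \<Rightarrow> nat \<Rightarrow> 'a" where
  "basis_fun k i = (if i = k then 1 else 0)"

lemma transvection_carrier [simp]:
  "corner x \<in> carrier_mat n n" "col_transvection u \<in> carrier_mat n n"
  "row_transvection w \<in> carrier_mat n n" "torus t \<in> carrier_mat n n"
  by (simp_all add: corner_def col_transvection_def row_transvection_def torus_def)

lemma col_mult_row_carrier [simp]:
  "col_transvection u * row_transvection w \<in> carrier_mat n n"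
  by (rule mult_carrier_mat[of _ n n]) simp_all

lemma transvection_dim [simp]:
  "dim_row (corner x) = n" "dim_col (corner x) = n"
  "dim_row (col_transvection u) = n" "dim_col (col_transvection u) = n"
  "dim_row (row_transvection w) = n" "dim_col (row_transvection w) = n"
  "dim_row (torus t) = n" "dim_col (torus t) = n"
  by (simp_all add: corner_def col_transvection_def row_transvection_def torus_def)

lemma corner_in_G: "x \<in> K \<Longrightarrow> corner x \<in> carrier G"
  unfolding in_ST_plus_iff by (auto simp: corner_def closed intro!: prod.neutral)

lemma col_transvection_in_G: "(\<And>i. i < l \<Longrightarrow> u i \<in> K) \<Longrightarrow> col_transvection u \<in> carrier G"
  unfolding in_ST_plus_iff by (auto simp: col_transvection_def closed intro!: prod.neutral)

lemma row_transvection_in_G: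
  "(\<And>j. 0 < j \<Longrightarrow> j < n \<Longrightarrow> w j \<in> K) \<Longrightarrow> row_transvection w \<in> carrier G"
  unfolding in_ST_plus_iff by (auto simp: row_transvection_def closed intro!: prod.neutral)

lemma torus_in_G: "t \<in> K \<Longrightarrow> t \<noteq> 0 \<Longrightarrow> torus t \<in> carrier G"
  unfolding in_ST_plus_iff
  by (auto simp: torus_def torus_entry_def closed prod.distrib)

lemma basis_fun_closed: "basis_fun k i \<in> K"
  by (simp add: basis_fun_def closed)

lemma corner_0: "corner 0 = 1\<^sub>m n"
  by (auto simp: corner_def)

lemma index_corner_mult:
  assumes "A \<in> carrier_mat n n" "i < n" "j < n"
  shows "(corner x * A) $$ (i, j) = A $$ (i, j) + (if i = 0 then x * A $$ (l, j) else 0)"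
proof -
  have "(corner x * A) $$ (i, j) = (\<Sum>k<n. corner x $$ (i, k) * A $$ (k, j))"
    using assms by (intro index_mult_square_mat) auto
  also have "\<dots> = (\<Sum>k<n. (if k = i then A $$ (k, j) else 0) +
      (if k = l then (if i = 0 then x * A $$ (k, j) else 0) else 0))"
    using assms by (intro sum.cong refl) (auto simp: corner_def algebra_simps)
  finally show ?thesis using assms by (simp add: sum.distrib)
qed

lemma index_col_transvection_mult:
  assumes "A \<in> carrier_mat n n" "i < n" "j < n"
  shows "(col_transvection u * A) $$ (i, j) = A $$ (i, j) + (if i < l then u i * A $$ (l, j) else 0)"
proof -
  have "(col_transvection u * A) $$ (i, j) = (\<Sum>k<n. col_transvection u $$ (i, k) * A $$ (k, j))"
    using assms by (intro index_mult_square_mat) auto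
  also have "\<dots> = (\<Sum>k<n. (if k = i then A $$ (k, j) else 0) +
      (if k = l then (if i < l then u i * A $$ (k, j) else 0) else 0))"
    using assms by (intro sum.cong refl) (auto simp: col_transvection_def algebra_simps)
  finally show ?thesis using assms by (simp add: sum.distrib)
qed

lemma index_mult_col_transvection_unit:
  assumes "A \<in> carrier_mat n n" "i < n" "j < n" "k < l"
  shows "(A * col_transvection (basis_fun k)) $$ (i, j) = A $$ (i, j) + (if j = l then A $$ (i, k) else 0)"
proof -
  have "(A * col_transvection (basis_fun k)) $$ (i, j) =
      (\<Sum>m<n. A $$ (i, m) * col_transvection (basis_fun k) $$ (m, j))"
    using assms by (intro index_mult_square_mat) auto
  also have "\<dots> = (\<Sum>m<n. (if m = j then A $$ (i, m) else 0) +
      (if m = k then (if j = l then A $$ (i, m) else 0) else 0))"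
    using assms by (intro sum.cong refl) (auto simp: col_transvection_def basis_fun_def algebra_simps)
  finally show ?thesis using assms n_eq by (simp add: sum.distrib)
qed

lemma index_row_transvection_unit_mult:
  assumes "A \<in> carrier_mat n n" "i < n" "j < n" "0 < k" "k < n"
  shows "(row_transvection (basis_fun k) * A) $$ (i, j) = A $$ (i, j) + (if i = 0 then A $$ (k, j) else 0)"
proof -
  have "(row_transvection (basis_fun k) * A) $$ (i, j) =
      (\<Sum>m<n. row_transvection (basis_fun k) $$ (i, m) * A $$ (m, j))"
    using assms by (intro index_mult_square_mat) auto
  also have "\<dots> = (\<Sum>m<n. (if m = i then A $$ (m, j) else 0) +
      (if m = k then (if i = 0 then A $$ (m, j) else 0) else 0))"
    using assms by (intro sum.cong refl) (auto simp: row_transvection_def basis_fun_def algebra_simps)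
  finally show ?thesis using assms by (simp add: sum.distrib)
qed

lemma index_mult_row_transvection:
  assumes "A \<in> carrier_mat n n" "i < n" "j < n"
  shows "(A * row_transvection w) $$ (i, j) = A $$ (i, j) + (if 0 < j then A $$ (i, 0) * w j else 0)"
proof -
  have "(A * row_transvection w) $$ (i, j) = (\<Sum>m<n. A $$ (i, m) * row_transvection w $$ (m, j))"
    using assms by (intro index_mult_square_mat) auto
  also have "\<dots> = (\<Sum>m<n. (if m = j then A $$ (i, m) else 0) +
      (if m = 0 then (if 0 < j then A $$ (i, m) * w j else 0) else 0))"
    using assms by (intro sum.cong refl) (auto simp: row_transvection_def algebra_simps)
  finally show ?thesis using assms by (simp add: sum.distrib)
qed

lemma index_torus_mult:
  assumes "A \<in> carrier_mat n n" "i < n" "j < n"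
  shows "(torus t * A) $$ (i, j) = torus_entry t i * A $$ (i, j)"
proof -
  have "(torus t * A) $$ (i, j) = (\<Sum>k<n. torus t $$ (i, k) * A $$ (k, j))"
    using assms by (intro index_mult_square_mat) auto
  also have "\<dots> = (\<Sum>k<n. if k = i then torus_entry t i * A $$ (k, j) else 0)"
    using assms by (intro sum.cong refl) (auto simp: torus_def)
  finally show ?thesis using assms by simp
qed

lemma index_mult_torus:
  assumes "A \<in> carrier_mat n n" "i < n" "j < n"
  shows "(A * torus t) $$ (i, j) = A $$ (i, j) * torus_entry t j"
proof -
  have "(A * torus t) $$ (i, j) = (\<Sum>k<n. A $$ (i, k) * torus t $$ (k, j))"
    using assms by (intro index_mult_square_mat) auto
  also have "\<dots> = (\<Sum>k<n. if k = j then A $$ (i, k) * torus_entry t j else 0)"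
    using assms by (intro sum.cong refl) (auto simp: torus_def)
  finally show ?thesis using assms by simp
qed

lemmas index_products = index_corner_mult index_col_transvection_mult
  index_mult_col_transvection_unit index_row_transvection_unit_mult index_mult_row_transvection
  index_torus_mult index_mult_torus

lemma corner_mult_corner: "corner x * corner y = corner (x + y)"
  by (rule eq_matI) (auto simp: index_products simp del: index_mult_mat(1), auto simp: corner_def)

text \<open>The first torus entry is \<open>t\<close> and the last one is \<open>inverse t\<close>, so conjugation multiplies the corner by a
  square. For size two these are the only multipliers available.\<close>

lemma torus_mult_corner: "t \<noteq> 0 \<Longrightarrow> torus t * corner x = corner (t\<^sup>2 * x) * torus t"
  by (rule eq_matI)
    (auto simp: index_products simp del: index_mult_mat(1),
     auto simp: corner_def torus_def torus_entry_def power2_eq_square)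

text \<open>The two families of transvections generate a Heisenberg group whose centre is the corner.\<close>

lemma row_unit_col_commutator:
  assumes "0 < i" "i < l"
  shows "corner (u i) * (col_transvection u * row_transvection (basis_fun i)) =
    row_transvection (basis_fun i) * col_transvection u"
  using assms
  by (intro eq_matI)
    (auto simp: index_products simp del: index_mult_mat(1),
     auto simp: col_transvection_def row_transvection_def basis_fun_def)

lemma row_col_unit_commutator:
  assumes "0 < j" "j < l"
  shows "corner (w j) * (col_transvection (basis_fun j) * row_transvection w) =
    row_transvection w * col_transvection (basis_fun j)"
  using assms
  by (intro eq_matI)
    (auto simp: index_products simp del: index_mult_mat(1),
     auto simp: col_transvection_def row_transvection_def basis_fun_def)

lemma corner_mult_col_transvection:
  "corner (u 0) * col_transvection (u(0 := 0)) = col_transvection u"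
  by (intro eq_matI)
    (auto simp: index_products simp del: index_mult_mat(1), auto simp: col_transvection_def)

lemma corner_mult_row_transvection:
  "corner (w l) * row_transvection (w(l := 0)) = row_transvection w"
  by (intro eq_matI)
    (auto simp: index_products simp del: index_mult_mat(1), auto simp: row_transvection_def corner_def)

lemma col_transvection_diff:
  assumes "k < l"
  shows "col_transvection (\<lambda>i. u i - basis_fun k i) * col_transvection (basis_fun k) = col_transvection u"
  using assms
  by (intro eq_matI)
    (auto simp: index_products simp del: index_mult_mat(1), auto simp: col_transvection_def basis_fun_def)

lemma row_transvection_diff:
  assumes "0 < k" "k < n"
  shows "row_transvection (basis_fun k) * row_transvection (\<lambda>i. w i - basis_fun k i) = row_transvection w"
  using assms
  by (intro eq_matI)
    (auto simp: index_products simp del: index_mult_mat(1), auto simp: row_transvection_def basis_fun_def)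

text \<open>Conjugating an elementary column transvection by a triangular matrix \<open>A\<close> spreads column \<open>k\<close> of \<open>A\<close>,
  divided by the last diagonal entry, over the last column. This is how the entries of \<open>A\<close> become accessible.\<close>

lemma conjugate_col_transvection:
  assumes A: "A \<in> carrier G" and k: "k < l"
  shows "col_transvection (\<lambda>i. A $$ (i, k) / A $$ (l, l)) * A = A * col_transvection (basis_fun k)"
proof -
  have "A $$ (l, l) \<noteq> 0" using diag_neq_0[OF A] by simp
  moreover have "i < l" if "i < n" "i \<noteq> l" for i using that n_eq by simp
  ultimately show ?thesis
    using GD[OF A] k
    by (intro eq_matI) (auto simp: index_products simp del: index_mult_mat(1))
qed

text \<open>Row transvections give access to the rows of \<open>A\<close> other than the first one, now divided by the first
  diagonal entry.\<close>

lemma conjugate_row_transvection: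
  assumes A: "A \<in> carrier G" and k: "0 < k" "k < n"
  shows "A * row_transvection (\<lambda>j. A $$ (k, j) / A $$ (0, 0)) = row_transvection (basis_fun k) * A"
proof -
  have "A $$ (0, 0) \<noteq> 0" using diag_neq_0[OF A] by simp
  then show ?thesis
    using GD[OF A] k
    by (intro eq_matI) (auto simp: index_products simp del: index_mult_mat(1))
qed

end

section \<open>Coarser Hausdorff group topologies\<close>

locale coarser_group_topology = triangular_group K v n l
  for K :: "'a::field set" and v n l +
  fixes \<sigma> :: "'a mat topology"
  assumes topological_group_\<sigma>: "topological_group G \<sigma>"
    and coarser: "\<And>U. openin \<sigma> U \<Longrightarrow> openin \<tau> U"
begin

lemma topspace_\<sigma>: "topspace \<sigma> = carrier G"
  using topological_group_\<sigma> by (simp add: topological_group_def)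

lemma limitin_\<tau>_imp_\<sigma>: "limitin \<tau> f A F \<Longrightarrow> limitin \<sigma> f A F"
  using coarser topological_group_\<tau> by (auto simp: limitin_def topspace_\<sigma> topological_group_def)

lemmas \<sigma>_cancel_left = topological_group_limit_cancel_left[OF topological_group_\<sigma>, unfolded ST_plus_sel]
lemmas \<sigma>_cancel_right = topological_group_limit_cancel_right[OF topological_group_\<sigma>, unfolded ST_plus_sel]
lemmas \<sigma>_mult = topological_group_limit_mult[OF topological_group_\<sigma>, unfolded ST_plus_sel]
lemmas \<sigma>_carrier = topological_group_limit_carrier[OF topological_group_\<sigma>]

lemma \<sigma>_const: "A \<in> carrier G \<Longrightarrow> limitin \<sigma> (\<lambda>_. A) A F"
  by (simp add: topspace_\<sigma>)

lemma torus_limit: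
  assumes t: "vtendsto t c F" "\<forall>\<^sub>F x in F. t x \<in> K" and c: "c \<in> K" "c \<noteq> 0"
  shows "limitin \<sigma> (\<lambda>x. torus (t x)) (torus c) F"
proof (rule limitin_\<tau>_imp_\<sigma>, unfold limitin_\<tau>, intro conjI allI impI)
  show "torus c \<in> carrier G" using c by (rule torus_in_G)
  have "0 < v c" using c v_nonneg[of c] by (simp add: v_eq_0_iff less_le)
  then have "\<forall>\<^sub>F x in F. 0 < v (t x)" using vtendsto_v[OF t(1)] by (simp add: order_tendstoD)
  with t(2) show "\<forall>\<^sub>F x in F. torus (t x) \<in> carrier G"
    by eventually_elim (auto intro: torus_in_G)
  fix i j assume "i < n" "j < n"
  then show "vtendsto (\<lambda>x. torus (t x) $$ (i, j)) (torus c $$ (i, j)) F"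
    using c t by (auto simp: torus_def torus_entry_def intro!: vtendsto_inverse vtendsto_mult)
qed

lemma corner_scale_limit:
  assumes \<psi>: "limitin \<sigma> (\<lambda>x. corner (\<psi> x)) (1\<^sub>m n) F" "\<forall>\<^sub>F x in F. \<psi> x \<in> K"
    and t: "vtendsto t c F" "\<forall>\<^sub>F x in F. t x \<in> K" and c: "c \<in> K" "c \<noteq> 0"
  shows "limitin \<sigma> (\<lambda>x. corner ((t x)\<^sup>2 * \<psi> x)) (1\<^sub>m n) F"
proof (rule \<sigma>_cancel_right)
  show "limitin \<sigma> (\<lambda>x. torus (t x)) (torus c) F" by (rule torus_limit) fact+
  then show "limitin \<sigma> (\<lambda>x. torus (t x) * corner (\<psi> x)) (torus c * 1\<^sub>m n) F"
    by (rule \<sigma>_mult) fact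
  show "\<forall>\<^sub>F x in F. corner ((t x)\<^sup>2 * \<psi> x) \<in> carrier G"
    using t(2) \<psi>(2) by eventually_elim (auto intro!: corner_in_G closed)
  have "0 < v c" using c v_nonneg[of c] by (simp add: v_eq_0_iff less_le)
  then have "\<forall>\<^sub>F x in F. 0 < v (t x)" using vtendsto_v[OF t(1)] by (simp add: order_tendstoD)
  then show "\<forall>\<^sub>F x in F. corner ((t x)\<^sup>2 * \<psi> x) * torus (t x) = torus (t x) * corner (\<psi> x)"
    by eventually_elim (subst torus_mult_corner, auto)
  show "1\<^sub>m n * torus c = torus c * 1\<^sub>m n"
    by (simp add: left_mult_one_mat[OF transvection_carrier(4)] right_mult_one_mat[OF transvection_carrier(4)])
qed (rule one_in_G)

text \<open>Otherwise there is a filter along which \<open>x\<close> tends to infinity although the corner matrix of \<open>x\<close> tends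
  to the identity. Conjugating by torus elements near \<open>1\<close> gives the corner matrices of \<open>(1 + d)\<^sup>2 x\<close> and
  \<open>(1 - d)\<^sup>2 x\<close>, with the same limit. For \<open>d = 1 / (4 x)\<close>, which tends to \<open>0\<close>, these two elements differ
  by exactly \<open>1\<close>, so the constant corner matrix of \<open>1\<close> would tend to the identity.\<close>

lemma corner_bounded:
  "\<exists>U R. openin \<sigma> U \<and> 1\<^sub>m n \<in> U \<and> (\<forall>x\<in>K. corner x \<in> U \<longrightarrow> v x < R)"
proof (rule ccontr)
  assume unbounded: "\<not> ?thesis"
  \<comment> \<open>the coarsest filter on \<open>K\<close> along which \<open>corner x\<close> tends to the identity and \<open>x\<close> to infinity\<close>
  define F where "F = inf (filtercomap corner (nhdsin \<sigma> (1\<^sub>m n))) (inf (principal K) (filtercomap v at_top))"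
  have "F \<noteq> bot"
  proof
    assume "F = bot"
    then have "eventually (\<lambda>_. False) F" by simp
    then obtain P Q where P: "eventually P (nhdsin \<sigma> (1\<^sub>m n))"
      and Q: "\<forall>\<^sub>F x in filtercomap v at_top. x \<in> K \<longrightarrow> Q x" and PQ: "\<And>x. P (corner x) \<Longrightarrow> \<not> Q x"
      unfolding F_def eventually_inf[of _ "filtercomap corner _"] eventually_filtercomap[of _ corner]
        inf_commute[of "principal K"] eventually_inf_principal
      by blast
    from P obtain U where U: "openin \<sigma> U" "1\<^sub>m n \<in> U" "\<And>A. A \<in> U \<Longrightarrow> P A"
      using one_in_G by (auto simp: eventually_nhdsin topspace_\<sigma>)
    from Q obtain R where "\<And>x. R \<le> v x \<Longrightarrow> x \<in> K \<Longrightarrow> Q x"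
      by (auto simp: eventually_filtercomap_at_top_linorder)
    with U PQ have "\<forall>x\<in>K. corner x \<in> U \<longrightarrow> v x < R" by (meson not_le)
    with U unbounded show False by blast
  qed
  have le: "F \<le> filtercomap corner (nhdsin \<sigma> (1\<^sub>m n))" "F \<le> principal K" "F \<le> filtercomap v at_top"
    by (auto simp: F_def intro: le_infI2)
  have corner: "limitin \<sigma> corner (1\<^sub>m n) F"
    unfolding limitin_def
  proof (intro conjI allI impI)
    fix U assume "openin \<sigma> U \<and> 1\<^sub>m n \<in> U"
    then have "eventually (\<lambda>A. A \<in> U) (nhdsin \<sigma> (1\<^sub>m n))" by (auto simp: eventually_nhdsin)
    then have "eventually (\<lambda>x. corner x \<in> U) (filtercomap corner (nhdsin \<sigma> (1\<^sub>m n)))"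
      by (rule eventually_filtercomapI)
    then show "eventually (\<lambda>x. corner x \<in> U) F" using le(1) by (rule filter_leD[rotated])
  qed (simp add: topspace_\<sigma> one_in_G)
  have K: "\<forall>\<^sub>F x in F. x \<in> K" using le(2) by (simp add: le_principal)
  have infinite: "filterlim v at_top F"
    using le(3) by (simp add: filterlim_iff_le_filtercomap)
  define d where "d x = inverse x / 4" for x :: 'a
  have four: "(4::'a) \<noteq> 0"
  proof -
    have "(4::'a) = 2 * 2" by simp
    then show ?thesis using two_neq_0 by (metis mult_eq_0_iff)
  qed
  have four_closed: "4 \<in> K" using mult_closed[OF two_closed two_closed] by simp
  have "vtendsto d (0 / 4) F"
    unfolding d_def using infinite four
    by (intro vtendsto_divide vtendsto_inverse_at_infinity vtendsto_const)
  then have d: "vtendsto d 0 F" by simp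
  have dK: "\<forall>\<^sub>F x in F. d x \<in> K"
    using K by eventually_elim (auto simp: d_def closed four_closed)
  have plus: "limitin \<sigma> (\<lambda>x. corner ((1 + d x)\<^sup>2 * x)) (1\<^sub>m n) F"
  proof (rule corner_scale_limit[OF corner K])
    show "vtendsto (\<lambda>x. 1 + d x) 1 F" using vtendsto_add[OF vtendsto_const d, of 1] by simp
    show "\<forall>\<^sub>F x in F. 1 + d x \<in> K" using dK by eventually_elim (auto simp: closed)
  qed (auto simp: closed)
  have minus: "limitin \<sigma> (\<lambda>x. corner ((1 - d x)\<^sup>2 * x)) (1\<^sub>m n) F"
  proof (rule corner_scale_limit[OF corner K])
    show "vtendsto (\<lambda>x. 1 - d x) 1 F" using vtendsto_diff[OF vtendsto_const d, of 1] by simp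
    show "\<forall>\<^sub>F x in F. 1 - d x \<in> K" using dK by eventually_elim (auto simp: closed)
  qed (auto simp: closed)
  have "limitin \<sigma> (\<lambda>x. corner 1) (1\<^sub>m n) F"
  proof (rule \<sigma>_cancel_right[OF minus plus])
    have "\<forall>\<^sub>F x in F. 0 < v x" using infinite by (simp add: filterlim_at_top_dense)
    then show "\<forall>\<^sub>F x in F. corner 1 * corner ((1 - d x)\<^sup>2 * x) = corner ((1 + d x)\<^sup>2 * x)"
    proof eventually_elim
      case (elim x)
      then have "x \<noteq> 0" by auto
      then have "4 * d x * x = 1" using four by (simp add: d_def)
      then have "1 + (1 - d x)\<^sup>2 * x = (1 + d x)\<^sup>2 * x" by (simp add: power2_eq_square algebra_simps)
      then show ?case by (simp add: corner_mult_corner)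
    qed
  qed (auto simp: corner_in_G closed one_in_G)
  then have "corner 1 = 1\<^sub>m n"
    by (rule topological_group_limit_unique[OF topological_group_\<sigma> \<open>F \<noteq> bot\<close>
          \<sigma>_const[OF corner_in_G[OF one_mem]]])
  then have "corner 1 $$ (0, l) = 1\<^sub>m n $$ (0, l)" by simp
  then show False by (simp add: corner_def)
qed

text \<open>Conjugation by a fixed torus element \<open>c\<close> with large absolute value keeps the limit, so \<open>c\<^sup>2 * \<psi>\<close> is eventually
  bounded by the constant of \<open>corner_bounded\<close>.\<close>

lemma corner_limit:
  assumes \<psi>: "limitin \<sigma> (\<lambda>x. corner (\<psi> x)) (1\<^sub>m n) F" "\<forall>\<^sub>F x in F. \<psi> x \<in> K"
  shows "vtendsto \<psi> 0 F"
proof -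
  obtain U R where U: "openin \<sigma> U" "1\<^sub>m n \<in> U" and R: "\<And>x. x \<in> K \<Longrightarrow> corner x \<in> U \<Longrightarrow> v x < R"
    using corner_bounded by blast
  obtain a where a: "a \<in> K" "0 < v a" "v a < 1" using v_nontrivial by blast
  then have "a \<noteq> 0" by auto
  have "R > 0" using R[of 0] U one_in_G by (simp add: corner_0 closed)
  have "\<forall>\<^sub>F x in F. v (\<psi> x) < \<epsilon>" if "\<epsilon> > 0" for \<epsilon>
  proof -
    have "(v a)\<^sup>2 < 1" using a by (simp add: power_less_one_iff)
    moreover have "0 < \<epsilon> / R" using that \<open>R > 0\<close> by simp
    ultimately obtain k where k: "((v a)\<^sup>2) ^ k < \<epsilon> / R" using real_arch_pow_inv by blast
    define c where "c = inverse (a ^ k)"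
    have c: "c \<in> K" "c \<noteq> 0" using a \<open>a \<noteq> 0\<close> by (auto simp: c_def closed)
    have "limitin \<sigma> (\<lambda>x. corner (c\<^sup>2 * \<psi> x)) (1\<^sub>m n) F"
      using c by (intro corner_scale_limit[OF \<psi>, of "\<lambda>_. c" c]) auto
    then have "\<forall>\<^sub>F x in F. corner (c\<^sup>2 * \<psi> x) \<in> U" using U by (rule limitinD)
    with \<psi>(2) show ?thesis
    proof eventually_elim
      case (elim x)
      then have "v (c\<^sup>2 * \<psi> x) < R" using R c by (simp add: closed)
      moreover have "v (c\<^sup>2 * \<psi> x) = v (\<psi> x) / ((v a)\<^sup>2) ^ k"
        by (simp add: c_def v_mult v_power v_inverse power_inverse divide_inverse mult.commute
            flip: power_mult)
      ultimately have "v (\<psi> x) < R * ((v a)\<^sup>2) ^ k"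
        using a by (simp add: pos_divide_less_eq)
      also have "\<dots> < \<epsilon>" using k \<open>R > 0\<close> by (simp add: field_simps)
      finally show ?case .
    qed
  qed
  then show ?thesis by (simp add: vtendsto_def tendsto_iff v_nonneg)
qed

text \<open>The entries below the first row are read off from commutators in the corner. What they contribute can
  then be split off, which leaves the first entry in the corner.\<close>

lemma col_transvection_limit:
  assumes u: "limitin \<sigma> (\<lambda>x. col_transvection (u x)) (1\<^sub>m n) F"
    and K: "\<forall>\<^sub>F x in F. \<forall>i<l. u x i \<in> K" and i: "i < l"
  shows "vtendsto (\<lambda>x. u x i) 0 F"
proof -
  have pos: "vtendsto (\<lambda>x. u x i) 0 F" if i: "0 < i" "i < l" for i
  proof (rule corner_limit, rule \<sigma>_cancel_right)
    have r: "row_transvection (basis_fun i) \<in> carrier G"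
      by (auto intro: row_transvection_in_G basis_fun_closed)
    show "limitin \<sigma> (\<lambda>x. col_transvection (u x) * row_transvection (basis_fun i))
        (1\<^sub>m n * row_transvection (basis_fun i)) F"
      by (intro \<sigma>_mult u \<sigma>_const r)
    show "limitin \<sigma> (\<lambda>x. row_transvection (basis_fun i) * col_transvection (u x))
        (row_transvection (basis_fun i) * 1\<^sub>m n) F"
      by (intro \<sigma>_mult u \<sigma>_const r)
    show K': "\<forall>\<^sub>F x in F. u x i \<in> K" using K by eventually_elim (use i in auto)
    then show "\<forall>\<^sub>F x in F. corner (u x i) \<in> carrier G"
      by eventually_elim (rule corner_in_G)
  qed (auto simp: row_unit_col_commutator i one_in_G right_mult_one_mat[OF transvection_carrier(3)]
      left_mult_one_mat[OF transvection_carrier(3)])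
  have "vtendsto (\<lambda>x. u x 0) 0 F"
  proof (rule corner_limit, rule \<sigma>_cancel_right[OF _ u])
    show "limitin \<sigma> (\<lambda>x. col_transvection ((u x)(0 := 0))) (1\<^sub>m n) F"
    proof (rule limitin_\<tau>_imp_\<sigma>, unfold limitin_\<tau>, intro conjI allI impI one_in_G)
      show "\<forall>\<^sub>F x in F. col_transvection ((u x)(0 := 0)) \<in> carrier G"
        using K by eventually_elim (auto intro!: col_transvection_in_G simp: closed)
      fix i j assume "i < n" "j < n"
      then have eq: "col_transvection ((u x)(0 := 0)) $$ (i, j) =
          1\<^sub>m n $$ (i, j) + (if 0 < i \<and> i < l \<and> j = l then u x i else 0)" for x
        by (auto simp: col_transvection_def)
      moreover have "vtendsto (\<lambda>x. if 0 < i \<and> i < l \<and> j = l then u x i else 0) 0 F"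
        using pos[of i] by (cases "0 < i \<and> i < l \<and> j = l") (simp_all only: if_True if_False simp_thms vtendsto_const)
      ultimately show "vtendsto (\<lambda>x. col_transvection ((u x)(0 := 0)) $$ (i, j)) (1\<^sub>m n $$ (i, j)) F"
        using vtendsto_add[OF vtendsto_const, of _ 0 F "1\<^sub>m n $$ (i, j)"] by (simp only: eq add_0_right)
    qed
    show K': "\<forall>\<^sub>F x in F. u x 0 \<in> K" using K by eventually_elim (use l_pos in auto)
    then show "\<forall>\<^sub>F x in F. corner (u x 0) \<in> carrier G"
      by eventually_elim (rule corner_in_G)
  qed (auto simp: corner_mult_col_transvection one_in_G)
  with pos i show ?thesis by (cases "i = 0") auto
qed

lemma row_transvection_limit:
  assumes w: "limitin \<sigma> (\<lambda>x. row_transvection (w x)) (1\<^sub>m n) F"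
    and K: "\<forall>\<^sub>F x in F. \<forall>j<n. 0 < j \<longrightarrow> w x j \<in> K" and j: "0 < j" "j < n"
  shows "vtendsto (\<lambda>x. w x j) 0 F"
proof -
  have less: "vtendsto (\<lambda>x. w x j) 0 F" if j: "0 < j" "j < l" for j
  proof (rule corner_limit, rule \<sigma>_cancel_right)
    have c: "col_transvection (basis_fun j) \<in> carrier G"
      by (auto intro: col_transvection_in_G basis_fun_closed)
    show "limitin \<sigma> (\<lambda>x. col_transvection (basis_fun j) * row_transvection (w x))
        (col_transvection (basis_fun j) * 1\<^sub>m n) F"
      by (intro \<sigma>_mult w \<sigma>_const c)
    show "limitin \<sigma> (\<lambda>x. row_transvection (w x) * col_transvection (basis_fun j))
        (1\<^sub>m n * col_transvection (basis_fun j)) F"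
      by (intro \<sigma>_mult w \<sigma>_const c)
    show K': "\<forall>\<^sub>F x in F. w x j \<in> K" using K by eventually_elim (use j n_eq in auto)
    then show "\<forall>\<^sub>F x in F. corner (w x j) \<in> carrier G"
      by eventually_elim (rule corner_in_G)
  qed (auto simp: row_col_unit_commutator j one_in_G right_mult_one_mat[OF transvection_carrier(2)]
      left_mult_one_mat[OF transvection_carrier(2)])
  have "vtendsto (\<lambda>x. w x l) 0 F"
  proof (rule corner_limit, rule \<sigma>_cancel_right[OF _ w])
    show "limitin \<sigma> (\<lambda>x. row_transvection ((w x)(l := 0))) (1\<^sub>m n) F"
    proof (rule limitin_\<tau>_imp_\<sigma>, unfold limitin_\<tau>, intro conjI allI impI one_in_G)
      show "\<forall>\<^sub>F x in F. row_transvection ((w x)(l := 0)) \<in> carrier G"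
        using K by eventually_elim (auto intro!: row_transvection_in_G simp: closed)
      fix i j assume "i < n" "j < n"
      then have eq: "row_transvection ((w x)(l := 0)) $$ (i, j) =
          1\<^sub>m n $$ (i, j) + (if 0 < j \<and> j < l \<and> i = 0 then w x j else 0)" for x
        using less_n_cases[of j] by (auto simp: row_transvection_def)
      moreover have "vtendsto (\<lambda>x. if 0 < j \<and> j < l \<and> i = 0 then w x j else 0) 0 F"
        using less[of j] by (cases "0 < j \<and> j < l \<and> i = 0") (simp_all only: if_True if_False simp_thms vtendsto_const)
      ultimately show "vtendsto (\<lambda>x. row_transvection ((w x)(l := 0)) $$ (i, j)) (1\<^sub>m n $$ (i, j)) F"
        using vtendsto_add[OF vtendsto_const, of _ 0 F "1\<^sub>m n $$ (i, j)"] by (simp only: eq add_0_right)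
    qed
    show K': "\<forall>\<^sub>F x in F. w x l \<in> K" using K by eventually_elim (use l_pos in auto)
    then show "\<forall>\<^sub>F x in F. corner (w x l) \<in> carrier G"
      by eventually_elim (rule corner_in_G)
  qed (auto simp: corner_mult_row_transvection one_in_G)
  with less j less_n_cases[of j] show ?thesis by auto
qed

lemma col_ratio_limit:
  assumes h: "limitin \<sigma> h (1\<^sub>m n) F" and k: "k < l" and i: "i < l"
  shows "vtendsto (\<lambda>x. h x $$ (i, k) / h x $$ (l, l)) (basis_fun k i) F"
proof -
  define u where "u x i = h x $$ (i, k) / h x $$ (l, l)" for x i
  have c: "col_transvection (basis_fun k) \<in> carrier G"
    by (auto intro: col_transvection_in_G basis_fun_closed)
  note hG = \<sigma>_carrier[OF h]
  have K: "\<forall>\<^sub>F x in F. \<forall>i<l. u x i \<in> K"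
    using hG by eventually_elim (use k n_eq GD(2) in \<open>auto simp: u_def intro!: closed\<close>)
  have uG: "\<forall>\<^sub>F x in F. col_transvection (u x) \<in> carrier G"
    using K by eventually_elim (auto intro: col_transvection_in_G)
  have lim: "limitin \<sigma> (\<lambda>x. col_transvection (u x)) (col_transvection (basis_fun k)) F"
  proof (rule \<sigma>_cancel_right[OF h _ uG _ c refl])
    show "limitin \<sigma> (\<lambda>x. h x * col_transvection (basis_fun k)) (col_transvection (basis_fun k) * 1\<^sub>m n) F"
      using \<sigma>_mult[OF h \<sigma>_const[OF c]]
      by (simp add: right_mult_one_mat[OF transvection_carrier(2)] left_mult_one_mat[OF transvection_carrier(2)])
    show "\<forall>\<^sub>F x in F. col_transvection (u x) * h x = h x * col_transvection (basis_fun k)"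
      using hG by eventually_elim (use conjugate_col_transvection k in \<open>auto simp: u_def[abs_def]\<close>)
  qed
  have K': "\<forall>\<^sub>F x in F. \<forall>i<l. u x i - basis_fun k i \<in> K"
    using K by eventually_elim (auto simp: closed basis_fun_closed)
  have "limitin \<sigma> (\<lambda>x. col_transvection (\<lambda>i. u x i - basis_fun k i)) (1\<^sub>m n) F"
  proof (rule \<sigma>_cancel_right[OF \<sigma>_const[OF c] lim])
    show "\<forall>\<^sub>F x in F. col_transvection (\<lambda>i. u x i - basis_fun k i) \<in> carrier G"
      using K' by eventually_elim (auto intro: col_transvection_in_G)
  qed (auto simp: one_in_G col_transvection_diff k left_mult_one_mat[OF transvection_carrier(2)])
  from col_transvection_limit[OF this K' i] show ?thesis
    by (simp add: u_def vtendsto_def)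
qed

lemma row_ratio_limit:
  assumes h: "limitin \<sigma> h (1\<^sub>m n) F" and k: "0 < k" "k < n" and j: "0 < j" "j < n"
  shows "vtendsto (\<lambda>x. h x $$ (k, j) / h x $$ (0, 0)) (basis_fun k j) F"
proof -
  define w where "w x j = h x $$ (k, j) / h x $$ (0, 0)" for x j
  have c: "row_transvection (basis_fun k) \<in> carrier G"
    by (auto intro: row_transvection_in_G basis_fun_closed)
  note hG = \<sigma>_carrier[OF h]
  have K: "\<forall>\<^sub>F x in F. \<forall>j<n. 0 < j \<longrightarrow> w x j \<in> K"
    using hG by eventually_elim (use k GD(2) in \<open>auto simp: w_def intro!: closed\<close>)
  have wG: "\<forall>\<^sub>F x in F. row_transvection (w x) \<in> carrier G"
    using K by eventually_elim (auto intro: row_transvection_in_G)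
  have lim: "limitin \<sigma> (\<lambda>x. row_transvection (w x)) (row_transvection (basis_fun k)) F"
  proof (rule \<sigma>_cancel_left[OF h _ wG _ c refl])
    show "limitin \<sigma> (\<lambda>x. row_transvection (basis_fun k) * h x) (1\<^sub>m n * row_transvection (basis_fun k)) F"
      using \<sigma>_mult[OF \<sigma>_const[OF c] h]
      by (simp add: right_mult_one_mat[OF transvection_carrier(3)] left_mult_one_mat[OF transvection_carrier(3)])
    show "\<forall>\<^sub>F x in F. h x * row_transvection (w x) = row_transvection (basis_fun k) * h x"
      using hG by eventually_elim (use conjugate_row_transvection k in \<open>auto simp: w_def[abs_def]\<close>)
  qed
  have K': "\<forall>\<^sub>F x in F. \<forall>j<n. 0 < j \<longrightarrow> w x j - basis_fun k j \<in> K"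
    using K by eventually_elim (auto simp: closed basis_fun_closed)
  have "limitin \<sigma> (\<lambda>x. row_transvection (\<lambda>j. w x j - basis_fun k j)) (1\<^sub>m n) F"
  proof (rule \<sigma>_cancel_left[OF \<sigma>_const[OF c] lim])
    show "\<forall>\<^sub>F x in F. row_transvection (\<lambda>j. w x j - basis_fun k j) \<in> carrier G"
      using K' by eventually_elim (auto intro: row_transvection_in_G)
  qed (auto simp: one_in_G row_transvection_diff k right_mult_one_mat[OF transvection_carrier(3)])
  from row_transvection_limit[OF this K' j] show ?thesis
    by (simp add: w_def vtendsto_def)
qed

text \<open>Column transvections give all columns but the last one, and row transvections all rows but the first
  one. The two normalisations are compatible because \<open>h (0, 0) / h (l, l)\<close> tends to \<open>1\<close>.\<close>

lemma ratio_limit_off_corner: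
  assumes h: "limitin \<sigma> h (1\<^sub>m n) F" and ij: "i < n" "j < n" "\<not> (i = 0 \<and> j = l)"
  shows "vtendsto (\<lambda>x. h x $$ (i, j) / h x $$ (l, l)) (if i = j then 1 else 0) F"
proof (cases "j < i")
  case True
  have "\<forall>\<^sub>F x in F. 0 = h x $$ (i, j) / h x $$ (l, l)"
    using \<sigma>_carrier[OF h] by eventually_elim (use True ij in \<open>auto simp: GD\<close>)
  from vtendsto_transform_eventually[OF vtendsto_const this] show ?thesis using True by simp
next
  case False
  show ?thesis
  proof (cases "j = l")
    case True
    then have i: "0 < i" using ij by auto
    have "vtendsto (\<lambda>x. (h x $$ (i, j) / h x $$ (0, 0)) * (h x $$ (0, 0) / h x $$ (l, l)))
        (basis_fun i j * basis_fun 0 0) F"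
      using i ij l_pos h by (intro vtendsto_mult row_ratio_limit col_ratio_limit) (auto simp: True)
    moreover have "\<forall>\<^sub>F x in F. (h x $$ (i, j) / h x $$ (0, 0)) * (h x $$ (0, 0) / h x $$ (l, l)) =
        h x $$ (i, j) / h x $$ (l, l)"
      using \<sigma>_carrier[OF h] by eventually_elim (use diag_neq_0 in auto)
    ultimately have "vtendsto (\<lambda>x. h x $$ (i, j) / h x $$ (l, l)) (basis_fun i j * basis_fun 0 0) F"
      by (rule vtendsto_transform_eventually)
    then show ?thesis by (auto simp: basis_fun_def)
  next
    case False
    with \<open>\<not> j < i\<close> ij less_n_cases[of j] have "i < l" "j < l" by auto
    then show ?thesis using col_ratio_limit[OF h, of j i] by (simp add: basis_fun_def)
  qed
qed

text \<open>Factor \<open>h = u * w\<close>, where \<open>w\<close> is diagonal up to the corner entry of \<open>h\<close>, and \<open>u\<close> is unipotent and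
  tends to the identity by the previous lemma. Nothing is known about the convergence of the diagonal
  part of \<open>w\<close>, but it commutes with the torus. So the commutator of \<open>w\<close> with a fixed torus element
  \<open>a\<close> is a corner matrix, and its entry is the ratio in question times the nonzero constant
  \<open>a\<^sup>2 - 1\<close>.\<close>

lemma ratio_limit_corner:
  assumes h: "limitin \<sigma> h (1\<^sub>m n) F"
  shows "vtendsto (\<lambda>x. h x $$ (0, l) / h x $$ (0, 0)) 0 F"
proof -
  define w where "w x = mat n n (\<lambda>(i, j). (if i = j then h x $$ (i, i) else 0) +
      (if i = 0 \<and> j = l then h x $$ (0, l) else 0))" for x
  define u where "u x = mat n n (\<lambda>(i, j). if i = j then 1
      else if i < j \<and> \<not> (i = 0 \<and> j = l) then h x $$ (i, j) / h x $$ (j, j) else 0)" for x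
  note hG = \<sigma>_carrier[OF h]
  have [simp]: "w x \<in> carrier_mat n n" "u x \<in> carrier_mat n n" for x
    by (auto simp: w_def u_def)
  have wG: "\<forall>\<^sub>F x in F. w x \<in> carrier G"
    using hG
  proof eventually_elim
    case (elim x)
    note g = GD[OF elim]
    have "(\<Prod>i<n. w x $$ (i, i)) = (\<Prod>i<n. h x $$ (i, i))"
      by (intro prod.cong refl) (auto simp: w_def)
    then have "(\<Prod>i<n. w x $$ (i, i)) = 1" using g(4) by (rule trans)
    moreover have "\<forall>i<n. \<forall>j<n. w x $$ (i, j) \<in> K" "\<forall>i<n. \<forall>j<i. w x $$ (i, j) = 0"
      using g(2) by (auto simp: w_def intro!: closed)
    ultimately show ?case by (simp add: in_ST_plus_iff)
  qed
  have uG: "\<forall>\<^sub>F x in F. u x \<in> carrier G"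
    using hG by eventually_elim (auto simp: u_def in_ST_plus_iff intro!: closed)
  have uw: "\<forall>\<^sub>F x in F. u x * w x = h x"
    using hG
  proof eventually_elim
    case (elim x)
    note g = GD[OF elim]
    show ?case
    proof (rule eq_matI)
      fix i j assume "i < dim_row (h x)" "j < dim_col (h x)"
      then have ij: "i < n" "j < n" using g by auto
      have "(u x * w x) $$ (i, j) = (\<Sum>k<n. u x $$ (i, k) * w x $$ (k, j))"
        using ij by (intro index_mult_square_mat) auto
      also have "\<dots> = (\<Sum>k<n. (if k = j then u x $$ (i, k) * h x $$ (j, j) else 0) +
          (if k = 0 then (if j = l then u x $$ (i, k) * h x $$ (0, l) else 0) else 0))"
        using ij by (intro sum.cong refl) (auto simp: w_def algebra_simps)
      also have "\<dots> = u x $$ (i, j) * h x $$ (j, j) + (if j = l then u x $$ (i, 0) * h x $$ (0, l) else 0)"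
        using ij by (simp add: sum.distrib)
      also have "\<dots> = h x $$ (i, j)"
        using ij g(3)[of i j] diag_neq_0[OF elim, of j] by (auto simp: u_def)
      finally show "(u x * w x) $$ (i, j) = h x $$ (i, j)" .
    qed (use g in \<open>auto simp: u_def w_def\<close>)
  qed
  have u: "limitin \<sigma> u (1\<^sub>m n) F"
  proof (rule limitin_\<tau>_imp_\<sigma>, unfold limitin_\<tau>, intro conjI allI impI one_in_G uG)
    fix i j assume ij: "i < n" "j < n"
    have "vtendsto (\<lambda>x. h x $$ (i, j) / h x $$ (j, j)) 0 F" if "i < j" "\<not> (i = 0 \<and> j = l)"
    proof -
      have "vtendsto (\<lambda>x. (h x $$ (i, j) / h x $$ (l, l)) / (h x $$ (j, j) / h x $$ (l, l)))
          ((if i = j then 1 else 0) / (if j = j then 1 else 0)) F"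
        using that ij by (intro vtendsto_divide ratio_limit_off_corner h) auto
      moreover have "\<forall>\<^sub>F x in F. (h x $$ (i, j) / h x $$ (l, l)) / (h x $$ (j, j) / h x $$ (l, l)) =
          h x $$ (i, j) / h x $$ (j, j)"
        using hG by eventually_elim (use diag_neq_0 in auto)
      ultimately have "vtendsto (\<lambda>x. h x $$ (i, j) / h x $$ (j, j))
          ((if i = j then 1 else 0) / (if j = j then 1 else 0)) F"
        by (rule vtendsto_transform_eventually)
      then show ?thesis using that by simp
    qed
    then show "vtendsto (\<lambda>x. u x $$ (i, j)) (1\<^sub>m n $$ (i, j)) F"
      using ij by (cases "i < j"; cases "i = 0"; cases "j = l") (auto simp: u_def)
  qed
  have w: "limitin \<sigma> w (1\<^sub>m n) F"
    by (rule \<sigma>_cancel_left[OF u h wG uw one_in_G]) simp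
  obtain a where a: "a \<in> K" "0 < v a" "v a < 1" using v_nontrivial by blast
  then have "a \<noteq> 0" by auto
  have "v (a\<^sup>2) < 1" using a by (simp add: power_less_one_iff v_power)
  then have a2: "a\<^sup>2 - 1 \<noteq> 0" by auto
  have t: "torus a \<in> carrier G" using a \<open>a \<noteq> 0\<close> by (simp add: torus_in_G)
  \<comment> \<open>the corner entry of the commutator of \<open>w x\<close> and \<open>torus a\<close>\<close>
  define y where "y x = (a\<^sup>2 - 1) * (h x $$ (0, l) / h x $$ (0, 0))" for x
  have yK: "\<forall>\<^sub>F x in F. y x \<in> K"
    using hG by eventually_elim (use a in \<open>auto simp: y_def GD intro!: closed\<close>)
  have yG: "\<forall>\<^sub>F x in F. corner (y x) \<in> carrier G"
    using yK by eventually_elim (rule corner_in_G)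
  have comm: "\<forall>\<^sub>F x in F. w x * (corner (y x) * torus a) = torus a * w x"
    using hG
  proof eventually_elim
    case (elim x)
    note nz = diag_neq_0[OF elim, of 0]
    have ct: "corner (y x) * torus a = mat n n (\<lambda>(i, j). (if i = j then torus_entry a i else 0) +
        (if i = 0 \<and> j = l then y x * torus_entry a l else 0))"
      by (rule eq_matI) (auto simp: index_products simp del: index_mult_mat(1), auto simp: corner_def)
    show ?case
    proof (rule eq_matI)
      fix i j assume "i < dim_row (torus a * w x)" "j < dim_col (torus a * w x)"
      then have ij: "i < n" "j < n" by (auto simp: torus_def w_def)
      have "(w x * (corner (y x) * torus a)) $$ (i, j) =
          (\<Sum>k<n. w x $$ (i, k) * (corner (y x) * torus a) $$ (k, j))"
        using ij by (intro index_mult_square_mat) (auto simp: ct)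
      also have "\<dots> = (\<Sum>k<n. (if k = j then w x $$ (i, k) * torus_entry a j else 0) +
          (if k = 0 then (if j = l then w x $$ (i, k) * (y x * torus_entry a l) else 0) else 0))"
        using ij by (intro sum.cong refl) (auto simp: ct algebra_simps)
      also have "\<dots> = w x $$ (i, j) * torus_entry a j +
          (if j = l then w x $$ (i, 0) * (y x * torus_entry a l) else 0)"
        using ij by (simp add: sum.distrib)
      also have "\<dots> = torus_entry a i * w x $$ (i, j)"
        using ij nz \<open>a \<noteq> 0\<close>
        by (auto simp: w_def y_def torus_entry_def field_simps power2_eq_square)
      also have "\<dots> = (torus a * w x) $$ (i, j)" using ij by (simp add: index_torus_mult del: index_mult_mat(1))
      finally show "(w x * (corner (y x) * torus a)) $$ (i, j) = (torus a * w x) $$ (i, j)" .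
    qed (auto simp: torus_def w_def ct)
  qed
  have "limitin \<sigma> (\<lambda>x. corner (y x) * torus a) (torus a) F"
  proof (rule \<sigma>_cancel_left[OF w _ _ comm t])
    show "limitin \<sigma> (\<lambda>x. torus a * w x) (torus a * 1\<^sub>m n) F"
      by (intro \<sigma>_mult w \<sigma>_const t)
    show "\<forall>\<^sub>F x in F. corner (y x) * torus a \<in> carrier G"
      using yG by eventually_elim (rule mult_in_G[OF _ t])
  qed (simp add: left_mult_one_mat[OF transvection_carrier(4)] right_mult_one_mat[OF transvection_carrier(4)])
  then have "limitin \<sigma> (\<lambda>x. corner (y x)) (1\<^sub>m n) F"
    by (rule \<sigma>_cancel_right[OF \<sigma>_const[OF t] _ yG _ one_in_G])
      (auto simp: left_mult_one_mat[OF transvection_carrier(4)])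
  from corner_limit[OF this yK] have "vtendsto (\<lambda>x. y x / (a\<^sup>2 - 1)) (0 / (a\<^sup>2 - 1)) F"
    using a2 by (intro vtendsto_divide) auto
  then show ?thesis using a2 by (simp add: y_def)
qed

lemma ratio_limit:
  assumes h: "limitin \<sigma> h (1\<^sub>m n) F" and ij: "i < n" "j < n"
  shows "vtendsto (\<lambda>x. h x $$ (i, j) / h x $$ (l, l)) (if i = j then 1 else 0) F"
proof (cases "i = 0 \<and> j = l")
  case True
  have "vtendsto (\<lambda>x. (h x $$ (0, l) / h x $$ (0, 0)) * (h x $$ (0, 0) / h x $$ (l, l))) (0 * 1) F"
    using ratio_limit_corner[OF h] ratio_limit_off_corner[OF h, of 0 0] by (intro vtendsto_mult) auto
  moreover have "\<forall>\<^sub>F x in F. (h x $$ (0, l) / h x $$ (0, 0)) * (h x $$ (0, 0) / h x $$ (l, l)) =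
      h x $$ (0, l) / h x $$ (l, l)"
    using \<sigma>_carrier[OF h] by eventually_elim (use diag_neq_0 in auto)
  ultimately have "vtendsto (\<lambda>x. h x $$ (0, l) / h x $$ (l, l)) (0 * 1) F"
    by (rule vtendsto_transform_eventually)
  then show ?thesis using True by simp
next
  case False
  with ratio_limit_off_corner[OF h ij] show ?thesis by simp
qed

lemma last_power_limit:
  assumes h: "limitin \<sigma> h (1\<^sub>m n) F"
  shows "vtendsto (\<lambda>x. (h x $$ (l, l)) ^ n) 1 F"
proof -
  have "vtendsto (\<lambda>x. inverse (\<Prod>i<n. h x $$ (i, i) / h x $$ (l, l))) (inverse (\<Prod>i<n. 1)) F"
    using ratio_limit[OF h] by (intro vtendsto_inverse vtendsto_prod) (force, simp)
  moreover have "\<forall>\<^sub>F x in F. inverse (\<Prod>i<n. h x $$ (i, i) / h x $$ (l, l)) = (h x $$ (l, l)) ^ n"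
    using \<sigma>_carrier[OF h] by eventually_elim (auto simp: GD prod_dividef)
  ultimately have "vtendsto (\<lambda>x. (h x $$ (l, l)) ^ n) (inverse (\<Prod>i<n. 1)) F"
    by (rule vtendsto_transform_eventually)
  then show ?thesis by simp
qed

text \<open>If the last entry stayed away from \<open>1\<close>, it would tend to \<open>- 1\<close> along a finer filter, and \<open>h\<close>
  would tend there to \<open>- I\<close>. This matrix has determinant \<open>1\<close> because \<open>n\<close> is even.\<close>

lemma last_limit_of_square:
  assumes h: "limitin \<sigma> h (1\<^sub>m n) F" and sq: "vtendsto (\<lambda>x. (h x $$ (l, l))\<^sup>2) 1 F" and n: "even n"
  shows "vtendsto (\<lambda>x. h x $$ (l, l)) 1 F"
proof (rule ccontr)
  assume "\<not> ?thesis"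
  then obtain \<epsilon> where \<epsilon>: "\<epsilon> > 0" "\<not> (\<forall>\<^sub>F x in F. v (h x $$ (l, l) - 1) < \<epsilon>)"
    by (auto simp: vtendsto_def tendsto_iff v_nonneg)
  define F' where "F' = inf F (principal {x. \<epsilon> \<le> v (h x $$ (l, l) - 1)})"
  have "F' \<noteq> bot"
    using \<epsilon>(2) by (simp add: F'_def trivial_limit_def eventually_inf_principal not_le)
  have le: "F' \<le> F" by (simp add: F'_def)
  have away: "\<forall>\<^sub>F x in F'. \<epsilon> \<le> v (h x $$ (l, l) - 1)"
    by (simp add: F'_def eventually_inf_principal)
  note h' = limitin_mono[OF h le]
  have last: "vtendsto (\<lambda>x. h x $$ (l, l)) (- 1) F'"
  proof (rule vtendsto_squeeze)
    have "((\<lambda>x. v ((h x $$ (l, l))\<^sup>2 - 1) / \<epsilon>) \<longlongrightarrow> 0 / \<epsilon>) F'"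
      using vtendsto_mono[OF sq le] \<epsilon>(1) unfolding vtendsto_def by (intro tendsto_divide) auto
    then show "((\<lambda>x. v ((h x $$ (l, l))\<^sup>2 - 1) / \<epsilon>) \<longlongrightarrow> 0) F'" by simp
    show "\<forall>\<^sub>F x in F'. v (h x $$ (l, l) - - 1) \<le> v ((h x $$ (l, l))\<^sup>2 - 1) / \<epsilon>"
      using away
    proof eventually_elim
      case (elim x)
      let ?a = "h x $$ (l, l)"
      \<comment> \<open>\<open>a\<^sup>2 - 1\<close> factors, and the factor \<open>a - 1\<close> is bounded below\<close>
      have "v (?a + 1) * \<epsilon> \<le> v (?a + 1) * v (?a - 1)"
        using elim by (intro mult_left_mono) (auto simp: v_nonneg)
      also have "\<dots> = v (?a\<^sup>2 - 1)"
        unfolding v_mult[symmetric] by (simp add: power2_eq_square algebra_simps)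
      finally show ?case using \<epsilon>(1) by (simp add: field_simps)
    qed
  qed
  define N :: "'a mat" where "N = mat n n (\<lambda>(i, j). if i = j then - 1 else 0)"
  have N: "N \<in> carrier G"
    using n by (auto simp: in_ST_plus_iff N_def closed)
  have "limitin \<tau> h N F'"
    unfolding limitin_\<tau>
  proof (intro conjI allI impI N \<sigma>_carrier[OF h'])
    fix i j assume ij: "i < n" "j < n"
    have "vtendsto (\<lambda>x. (h x $$ (i, j) / h x $$ (l, l)) * h x $$ (l, l)) ((if i = j then 1 else 0) * - 1) F'"
      using ij by (intro vtendsto_mult last ratio_limit h')
    moreover have "\<forall>\<^sub>F x in F'. (h x $$ (i, j) / h x $$ (l, l)) * h x $$ (l, l) = h x $$ (i, j)"
      using \<sigma>_carrier[OF h'] by eventually_elim (use diag_neq_0 in auto)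
    ultimately have "vtendsto (\<lambda>x. h x $$ (i, j)) ((if i = j then 1 else 0) * - 1) F'"
      by (rule vtendsto_transform_eventually)
    then show "vtendsto (\<lambda>x. h x $$ (i, j)) (N $$ (i, j)) F'"
      using ij by (auto simp: N_def)
  qed
  then have "1\<^sub>m n = N"
    using topological_group_limit_unique[OF topological_group_\<sigma> \<open>F' \<noteq> bot\<close> h'] limitin_\<tau>_imp_\<sigma> by blast
  then have "1\<^sub>m n $$ (0, 0) = N $$ (0, 0)" by simp
  then have "(1::'a) = - 1" by (simp add: N_def)
  then have "(2::'a) = 0" by (metis one_add_one add.right_inverse)
  then show False using two_neq_0 by simp
qed

text \<open>The last entry of \<open>h * h\<close> is the square of the last entry of \<open>h\<close>, and \<open>h * h\<close> tends to the
  identity as well.\<close>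

lemma last_limit_of_power:
  assumes "limitin \<sigma> h (1\<^sub>m n) F" "vtendsto (\<lambda>x. (h x $$ (l, l)) ^ (2 ^ k)) 1 F" "even n"
  shows "vtendsto (\<lambda>x. h x $$ (l, l)) 1 F"
  using assms(1,2)
proof (induction k arbitrary: h)
  case (Suc k)
  have sq: "\<forall>\<^sub>F x in F. (h x * h x) $$ (l, l) = (h x $$ (l, l))\<^sup>2"
    using \<sigma>_carrier[OF Suc.prems(1)]
  proof eventually_elim
    case (elim x)
    then show ?case
      using GD[OF elim] by (simp add: index_diag_mult_triangular[of _ n] power2_eq_square del: index_mult_mat(1))
  qed
  have "limitin \<sigma> (\<lambda>x. h x * h x) (1\<^sub>m n) F"
    using \<sigma>_mult[OF Suc.prems(1) Suc.prems(1)] by simp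
  moreover have "\<forall>\<^sub>F x in F. ((h x * h x) $$ (l, l)) ^ (2 ^ k) = (h x $$ (l, l)) ^ (2 ^ Suc k)"
    using sq by eventually_elim (simp flip: power_mult del: index_mult_mat(1))
  then have "vtendsto (\<lambda>x. ((h x * h x) $$ (l, l)) ^ (2 ^ k)) 1 F"
    using Suc.prems(2) by (simp only: vtendsto_cong)
  ultimately have "vtendsto (\<lambda>x. (h x * h x) $$ (l, l)) 1 F" by (rule Suc.IH)
  then have "vtendsto (\<lambda>x. (h x $$ (l, l))\<^sup>2) 1 F"
    using sq by (simp only: vtendsto_cong)
  then show ?case by (rule last_limit_of_square[OF Suc.prems(1) _ assms(3)])
qed simp

lemma coarser_eq:
  assumes n: "n = 2 ^ k"
  shows "\<sigma> = \<tau>"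
proof (rule topological_group_eqI[OF topological_group_\<sigma> topological_group_\<tau> coarser])
  let ?F = "nhdsin \<sigma> (1\<^sub>m n)"
  have h: "limitin \<sigma> (\<lambda>x. x) (1\<^sub>m n) ?F"
    by (intro limitin_nhdsin_id) (simp add: topspace_\<sigma> one_in_G)
  have "k \<noteq> 0" using n n_eq l_pos by (intro notI) simp
  then have "even n" using n by simp
  then have last: "vtendsto (\<lambda>x. x $$ (l, l)) 1 ?F"
    using last_limit_of_power[OF h, of k] last_power_limit[OF h] n by simp
  have "limitin \<tau> (\<lambda>x. x) (1\<^sub>m n) ?F"
    unfolding limitin_\<tau>
  proof (intro conjI allI impI one_in_G \<sigma>_carrier[OF h])
    fix i j assume ij: "i < n" "j < n"
    have "vtendsto (\<lambda>x. (x $$ (i, j) / x $$ (l, l)) * x $$ (l, l)) ((if i = j then 1 else 0) * 1) ?F"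
      using ij by (intro vtendsto_mult last ratio_limit h)
    moreover have "\<forall>\<^sub>F x in ?F. (x $$ (i, j) / x $$ (l, l)) * x $$ (l, l) = x $$ (i, j)"
      using \<sigma>_carrier[OF h] by eventually_elim (use diag_neq_0 in auto)
    ultimately have "vtendsto (\<lambda>x. x $$ (i, j)) ((if i = j then 1 else 0) * 1) ?F"
      by (rule vtendsto_transform_eventually)
    then show "vtendsto (\<lambda>x. x $$ (i, j)) (1\<^sub>m n $$ (i, j)) ?F"
      using ij by auto
  qed
  then show "limitin \<tau> (\<lambda>x. x) \<one>\<^bsub>G\<^esub> (nhdsin \<sigma> \<one>\<^bsub>G\<^esub>)" by simp
qed

end

context triangular_group
begin

theorem minimal_if_power_of_two:
  assumes "n = 2 ^ k"
  shows "minimal_topological_group G \<tau>"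
  unfolding minimal_topological_group_iff_coarser
proof (intro conjI allI impI topological_group_\<tau>)
  fix S assume S: "topological_group G S \<and> (\<forall>U. openin S U \<longrightarrow> openin \<tau> U)"
  interpret coarser_group_topology K v n l S
    by unfold_locales (use S in auto)
  show "S = \<tau>" using assms by (rule coarser_eq)
qed

end

section \<open>Fermat primes\<close>

text \<open>If \<open>s\<close> is odd, then \<open>2 ^ a + 1\<close> divides \<open>2 ^ (a * s) + 1\<close>, so a prime of the form \<open>2 ^ k + 1\<close>
  leaves no room for an odd factor of \<open>k\<close>.\<close>

lemma fermat_prime_iff_power_of_two:
  assumes p: "prime p" "odd p"
  shows "fermat_prime p \<longleftrightarrow> (\<exists>k. p - 1 = 2 ^ k)"
proof
  assume "fermat_prime p"
  then show "\<exists>k. p - 1 = 2 ^ k" by (auto simp: fermat_prime_def)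
next
  assume "\<exists>k. p - 1 = 2 ^ k"
  then obtain k where "p - 1 = 2 ^ k" by blast
  then have k: "p = 2 ^ k + 1" using prime_gt_1_nat[OF p(1)] by simp
  have "k \<noteq> 0" using k p by (intro notI) auto
  then obtain s :: nat where s: "k = 2 ^ multiplicity 2 k * s" "\<not> 2 dvd s"
    using multiplicity_decompose'[of k 2] by auto
  have "s = 1"
  proof (rule ccontr)
    assume "s \<noteq> 1"
    define a :: nat where "a = 2 ^ multiplicity 2 k"
    define x :: int where "x = 2 ^ a"
    have "[x = - 1] (mod x + 1)" by (simp add: cong_iff_dvd_diff)
    then have "[x ^ s = (- 1) ^ s] (mod x + 1)" by (rule cong_pow)
    then have "x + 1 dvd x ^ s + 1" using s(2) by (simp add: cong_iff_dvd_diff)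
    moreover have "x ^ s = 2 ^ k" using s(1) by (simp add: x_def a_def flip: power_mult)
    then have "int p = x ^ s + 1" by (simp add: k)
    moreover have "int (2 ^ a + 1) = x + 1" by (simp add: x_def)
    ultimately have "int (2 ^ a + 1) dvd int p" by (simp only:)
    then have "2 ^ a + 1 dvd p" by (simp only: int_dvd_int_iff)
    moreover have "(2::nat) ^ a + 1 \<noteq> 1" by simp
    ultimately have "2 ^ a + 1 = p" using p(1) by (metis prime_nat_iff)
    then have "(2::nat) ^ a = 2 ^ k" using k by simp
    then have "a = k" by simp
    with s(1) \<open>k \<noteq> 0\<close> \<open>s \<noteq> 1\<close> show False by (simp add: a_def)
  qed
  then have "p = 2 ^ (2 ^ multiplicity 2 k) + 1" using k s(1) by simp
  then show "fermat_prime p" using p by (auto simp: fermat_prime_def)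
qed

lemma odd_prime_divisor_if_not_power_of_two:
  fixes n :: nat
  assumes n: "0 < n" and not_power: "\<And>k. n \<noteq> 2 ^ k"
  obtains q where "prime q" "odd q" "q dvd n"
proof -
  obtain s :: nat where s: "n = 2 ^ multiplicity 2 n * s" "\<not> 2 dvd s"
    using multiplicity_decompose'[of n 2] n by auto
  have "s \<noteq> 1" using s(1) not_power[of "multiplicity 2 n"] by auto
  then obtain q where q: "prime q" "q dvd s" using prime_factor_nat by blast
  have "odd q" using q(2) s(2) dvd_trans by blast
  moreover have "q dvd n" using q(2) s(1) by (metis dvd_mult)
  ultimately show ?thesis using q(1) that by blast
qed

section \<open>The rationals with the p-adic absolute value\<close>

lemma padic_abs_mult:
  assumes p: "prime p"
  shows "padic_abs p (x * y) = padic_abs p x * padic_abs p y"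
proof (cases "x = 0 \<or> y = 0")
  case True
  then show ?thesis by (auto simp: padic_abs_def)
next
  case False
  obtain a b where ab: "quotient_of x = (a, b)" by fastforce
  obtain c d where cd: "quotient_of y = (c, d)" by fastforce
  have bd: "b > 0" "d > 0"
    using quotient_of_denom_pos[OF ab] quotient_of_denom_pos[OF cd] by auto
  have x: "x = of_int a / of_int b" and y: "y = of_int c / of_int d"
    using quotient_of_div[OF ab] quotient_of_div[OF cd] by auto
  have ac: "a \<noteq> 0" "c \<noteq> 0" using False x y by auto
  have "padic_val p (x * y) = padic_val p (of_int (a * c) / of_int (b * d))"
    by (simp add: x y)
  also have "\<dots> = int (multiplicity (int p) (a * c)) - int (multiplicity (int p) (b * d))"
    using ac bd by (intro padic_val_divide p) auto
  also have "\<dots> = padic_val p x + padic_val p y"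
    using ac bd p by (simp add: x y padic_val_divide prime_elem_multiplicity_mult_distrib)
  finally have "padic_val p (x * y) = padic_val p x + padic_val p y" .
  moreover have "real p \<noteq> 0" using prime_gt_0_nat[OF p] by simp
  ultimately show ?thesis using False by (simp add: padic_abs_def power_int_diff power_int_minus field_simps power_int_add)
qed

lemma padic_abs_of_int_le:
  assumes p: "prime p" and dvd: "int p ^ k dvd m"
  shows "padic_abs p (of_int m) \<le> (1 / real p) ^ k"
proof (cases "m = 0")
  case False
  have "\<not> is_unit (int p)" using p by (simp add: prime_nat_iff)
  then have "k \<le> multiplicity (int p) m" using False dvd by (intro multiplicity_geI) auto
  moreover have "padic_val p (of_int m) = int (multiplicity (int p) m)"
    using padic_val_divide[OF p False, of 1] by simp
  moreover have "real p > 1" using prime_gt_1_nat[OF p] by simp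
  ultimately have "padic_abs p (of_int m) = (1 / real p) ^ multiplicity (int p) m"
    "(1 / real p) ^ multiplicity (int p) m \<le> (1 / real p) ^ k"
    using False by (auto simp: padic_abs_def power_int_minus power_one_over field_simps
        intro!: power_decreasing)
  then show ?thesis by simp
qed (simp add: padic_abs_def)

lemma padic_abs_of_int_eq_1:
  assumes p: "prime p" and ndvd: "\<not> int p dvd m"
  shows "padic_abs p (of_int m) = 1"
proof -
  have "m \<noteq> 0" using ndvd by auto
  moreover from this have "padic_val p (of_int m) = int (multiplicity (int p) m)"
    using padic_val_divide[OF p, of m 1] by simp
  ultimately show ?thesis using ndvd by (simp add: padic_abs_def not_dvd_imp_multiplicity_0)
qed

lemma valued_subfield_padic:
  assumes p: "prime p"
  shows "valued_subfield (UNIV :: rat set) (padic_abs p)"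
proof -
  interpret M: Metric_space UNIV "padic_dist p" by (rule Metric_space_padic[OF p])
  have dist: "padic_dist p x 0 = padic_abs p x" "padic_dist p x (- y) = padic_abs p (x + y)" for x y
    by (simp_all add: padic_dist_def)
  have neg: "padic_dist p 0 (- y) = padic_abs p y" for y by (simp add: padic_dist_def)
  have p1: "real p > 1" using prime_gt_1_nat[OF p] by simp
  show ?thesis
  proof
    show "0 \<le> padic_abs p x" for x using M.nonneg[of x 0] by (simp add: dist)
    show "padic_abs p x = 0 \<longleftrightarrow> x = 0" for x using M.zero[of x 0] by (simp add: dist)
    show "padic_abs p (x * y) = padic_abs p x * padic_abs p y" for x y
      by (rule padic_abs_mult[OF p])
    show "padic_abs p (x + y) \<le> padic_abs p x + padic_abs p y" for x y
      using M.triangle[of x 0 "- y"] by (simp add: dist neg)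
    have "padic_abs p (of_int (int p)) \<le> (1 / real p) ^ 1"
      by (rule padic_abs_of_int_le[OF p]) simp
    also have "\<dots> < 1" using p1 by simp
    finally have "padic_abs p (of_int (int p)) < 1" .
    moreover have "padic_abs p (of_int (int p)) > 0"
      using p1 by (simp add: padic_abs_def)
    ultimately show "\<exists>x\<in>UNIV. 0 < padic_abs p x \<and> padic_abs p x < 1" by blast
  qed auto
qed

lemma odd_root_of_unity_rat:
  fixes x :: rat
  assumes "odd q" "x ^ q = 1"
  shows "x = 1"
proof -
  have "0 < x ^ q" using assms by simp
  then have "0 < x" using assms(1) unfolding zero_less_power_eq by auto
  then show ?thesis using assms odd_pos[OF assms(1)] by (intro power_eq_imp_eq_base[of x q 1]) auto
qed

text \<open>The powers \<open>x k = g ^ (c * p ^ k)\<close> of a primitive root \<open>g\<close>, where \<open>p - 1 = q * c\<close>, approach a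
  primitive root of unity of order \<open>q\<close> in the \<open>p\<close>-adic numbers.\<close>

lemma padic_approximate_roots_of_unity:
  assumes p: "prime p" and q: "1 < q" "q dvd p - 1"
  obtains x :: "nat \<Rightarrow> rat" where "(\<lambda>k. padic_abs p (x k ^ q - 1)) \<longlonglongrightarrow> 0"
    "\<And>k. padic_abs p (x k - 1) = 1"
proof -
  obtain g where g: "residue_primroot p g"
    using prime_primitive_root_exists[OF prime_gt_1_nat[OF p] p] by blast
  then have ord: "ord p g = p - 1" and cop: "coprime p g"
    by (auto simp: residue_primroot_def totient_prime p)
  have p1: "p > 1" using prime_gt_1_nat[OF p] .
  obtain c where c: "p - 1 = q * c" using q(2) by blast
  define x :: "nat \<Rightarrow> rat" where "x k = of_int (int g ^ (c * p ^ k))" for k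
  have small: "padic_abs p (x k ^ q - 1) \<le> (1 / real p) ^ Suc k" for k
  proof -
    have "coprime g (p ^ Suc k)" using cop by (simp add: coprime_commute)
    then have "[g ^ totient (p ^ Suc k) = 1] (mod p ^ Suc k)" by (rule euler_theorem)
    moreover have "totient (p ^ Suc k) = c * p ^ k * q"
      by (simp only: totient_prime_power_Suc[OF p] c ac_simps)
    ultimately have "[int g ^ (c * p ^ k * q) = 1] (mod int p ^ Suc k)"
      by (metis cong_int_iff of_nat_1 of_nat_power)
    then have "int p ^ Suc k dvd int g ^ (c * p ^ k * q) - 1"
      by (simp add: cong_iff_dvd_diff)
    then have "padic_abs p (of_int (int g ^ (c * p ^ k * q) - 1)) \<le> (1 / real p) ^ Suc k"
      by (rule padic_abs_of_int_le[OF p])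
    then show ?thesis by (simp add: x_def flip: power_mult)
  qed
  interpret valued_subfield "UNIV :: rat set" "padic_abs p" by (rule valued_subfield_padic[OF p])
  have lim: "(\<lambda>k. (1 / real p) ^ Suc k) \<longlonglongrightarrow> 0"
    using p1 by (intro LIMSEQ_Suc LIMSEQ_realpow_zero) auto
  have "(\<lambda>k. padic_abs p (x k ^ q - 1)) \<longlonglongrightarrow> 0"
    by (rule tendsto_sandwich[OF always_eventually always_eventually tendsto_const lim])
      (use small v_nonneg in auto)
  moreover have "padic_abs p (x k - 1) = 1" for k
  proof -
    have "\<not> p - 1 dvd c * p ^ k"
    proof
      assume "p - 1 dvd c * p ^ k"
      then have "q * c dvd p ^ k * c" by (simp only: c mult.commute)
      moreover have "c \<noteq> 0" using c p1 by (intro notI) simp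
      ultimately have "q dvd p ^ k" by simp
      moreover have "coprime q (p ^ k)"
      proof -
        have "coprime (p - 1) p" using coprime_diff_one_left_nat[of p] p1 by simp
        then show ?thesis using q(2) by (meson coprime_divisors coprime_power_right_iff dvd_refl)
      qed
      ultimately have "is_unit q" using coprime_absorb_left[of q "p ^ k"] by simp
      with q(1) show False by simp
    qed
    then have "\<not> [g ^ (c * p ^ k) = 1] (mod p)" by (simp only: ord_divides ord not_False_eq_True)
    then have "\<not> [int g ^ (c * p ^ k) = 1] (mod int p)"
      by (metis cong_int_iff of_nat_1 of_nat_power)
    then have "\<not> int p dvd int g ^ (c * p ^ k) - 1" by (simp add: cong_iff_dvd_diff)
    from padic_abs_of_int_eq_1[OF p this] show ?thesis by (simp add: x_def)
  qed
  ultimately show ?thesis by (rule that)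
qed

section \<open>The Gaussian rationals\<close>

lemma in_gaussian_rationals_iff: "z \<in> gaussian_rationals \<longleftrightarrow> Re z \<in> \<rat> \<and> Im z \<in> \<rat>"
  by (cases z) (auto simp: gaussian_rationals_def)

lemma valued_subfield_gaussian: "valued_subfield gaussian_rationals norm"
proof
  show "\<exists>x\<in>gaussian_rationals. 0 < norm x \<and> norm x < 1"
    by (intro bexI[of _ "1 / 2"]) (auto simp: in_gaussian_rationals_iff norm_divide)
qed (auto simp: in_gaussian_rationals_iff norm_mult norm_triangle_ineq simp flip: power2_eq_square)

text \<open>If \<open>2 * Re z = r / s\<close> in lowest terms, then \<open>s ^ k * (z ^ k + cnj z ^ k)\<close> is an integer congruent to
  \<open>r ^ k\<close> modulo \<open>s\<close>, because \<open>z ^ k + cnj z ^ k\<close> satisfies a linear recurrence. If \<open>z ^ k = 1\<close>, then it is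
  \<open>2 * s ^ k\<close>, so \<open>s\<close> divides \<open>r ^ k\<close>.\<close>

lemma root_of_unity_double_Re_integer:
  assumes z: "Re z \<in> \<rat>" "z ^ m = 1" "0 < m"
  shows "2 * Re z \<in> \<int>"
proof -
  have norm: "norm z = 1" using power_eq_1_iff[OF z(2)] z(3) by simp
  then have unit: "z * cnj z = 1" by (simp add: complex_norm_square[symmetric])
  have "2 * Re z \<in> \<rat>" using z(1) by simp
  then obtain r s :: int where rs: "2 * Re z = of_int r / of_int s" "s > 0" "coprime r s"
    by (metis Rats_cases')
  have sum: "of_int s * (z + cnj z) = (of_int r :: complex)"
    using rs(1,2) by (simp add: complex_add_cnj field_simps complex_eq_iff)
  have rec: "\<exists>a b. of_int s ^ k * (z ^ k + cnj z ^ k) = (of_int a :: complex) \<and>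
      of_int s ^ Suc k * (z ^ Suc k + cnj z ^ Suc k) = (of_int b :: complex) \<and> [b = r ^ Suc k] (mod s)" for k
  proof (induction k)
    case 0
    show ?case using sum by (intro exI[of _ 2] exI[of _ r]) simp
  next
    case (Suc k)
    then obtain a b where a: "of_int s ^ k * (z ^ k + cnj z ^ k) = (of_int a :: complex)"
      and b: "of_int s ^ Suc k * (z ^ Suc k + cnj z ^ Suc k) = (of_int b :: complex)"
      and cong: "[b = r ^ Suc k] (mod s)" by blast
    have "of_int s ^ Suc (Suc k) * (z ^ Suc (Suc k) + cnj z ^ Suc (Suc k)) =
        (of_int s * (z + cnj z)) * (of_int s ^ Suc k * (z ^ Suc k + cnj z ^ Suc k)) -
        of_int s ^ 2 * (z * cnj z) * (of_int s ^ k * (z ^ k + cnj z ^ k))"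
      by (simp add: algebra_simps power2_eq_square)
    also have "\<dots> = of_int (r * b - s ^ 2 * a)" by (simp only: a b sum unit) simp
    finally have "of_int s ^ Suc (Suc k) * (z ^ Suc (Suc k) + cnj z ^ Suc (Suc k)) =
        (of_int (r * b - s ^ 2 * a) :: complex)" .
    moreover have "[r * b - s ^ 2 * a = r * r ^ Suc k - 0] (mod s)"
      by (intro cong_diff cong_mult cong cong_refl) (simp add: cong_0_iff power2_eq_square)
    ultimately show ?case using b by (intro exI[of _ b] exI[of _ "r * b - s ^ 2 * a"]) simp
  qed
  obtain k where k: "m = Suc k" using z(3) gr0_conv_Suc by blast
  from rec[of k] obtain b where b: "of_int s ^ m * (z ^ m + cnj z ^ m) = (of_int b :: complex)"
    "[b = r ^ m] (mod s)"
    unfolding k by blast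
  have "cnj z ^ m = 1" using z(2) by (metis complex_cnj_one complex_cnj_power)
  then have "of_int (s ^ m * 2) = (of_int b :: complex)" using b(1) z(2) by simp
  then have "b = s ^ m * 2" by (simp only: of_int_eq_iff)
  then have "s dvd b" using z(3) by simp
  then have "s dvd r ^ m" using b(2) by (simp add: cong_dvd_iff)
  moreover have "coprime s (r ^ m)" using rs(3) by (simp add: coprime_commute)
  ultimately have "is_unit s" using coprime_absorb_left[of s "r ^ m"] by simp
  then have "s = 1" using rs(2) by simp
  then show ?thesis using rs(1) by simp
qed

text \<open>Both \<open>2 * Re z\<close> and \<open>2 * Im z\<close> are integers, the second one because \<open>\<i> * z\<close> is a root of unity,
  too. Their squares add up to \<open>4\<close>, which leaves the four powers of \<open>\<i>\<close>.\<close>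

lemma odd_root_of_unity_gaussian:
  assumes z: "z \<in> gaussian_rationals" and q: "odd q" "z ^ q = 1"
  shows "z = 1"
proof -
  have q0: "0 < q" using q(1) by (rule odd_pos)
  have "2 * Re z \<in> \<int>"
    using z q(2) q0 by (intro root_of_unity_double_Re_integer[of z q]) (auto simp: in_gaussian_rationals_iff)
  then obtain a where a: "2 * Re z = of_int a" by (auto elim: Ints_cases)
  have "(\<i> * z) ^ (4 * q) = 1"
  proof -
    have "(\<i> * z) ^ (4 * q) = (\<i> ^ 4) ^ q * (z ^ q) ^ 4"
      by (simp only: power_mult_distrib power_mult[symmetric] mult.commute)
    then show ?thesis using q(2) by simp
  qed
  then have "2 * Re (\<i> * z) \<in> \<int>"
    using z q0 by (intro root_of_unity_double_Re_integer[of "\<i> * z" "4 * q"]) (auto simp: in_gaussian_rationals_iff)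
  then have "2 * Im z \<in> \<int>" using Ints_minus by fastforce
  then obtain b where b: "2 * Im z = of_int b" by (auto elim: Ints_cases)
  have "norm z = 1" using power_eq_1_iff[OF q(2)] q0 by simp
  then have "(Re z)\<^sup>2 + (Im z)\<^sup>2 = 1" by (simp add: cmod_def)
  then have "(2 * Re z)\<^sup>2 + (2 * Im z)\<^sup>2 = 4" by (simp add: power_mult_distrib)
  then have "(of_int (a\<^sup>2 + b\<^sup>2) :: real) = of_int 4" by (simp add: a b)
  then have ab: "a\<^sup>2 + b\<^sup>2 = 4" by (simp only: of_int_eq_iff)
  have "a\<^sup>2 \<le> 4" using ab zero_le_power2[of b] by linarith
  moreover have "b\<^sup>2 \<le> 4" using ab zero_le_power2[of a] by linarith
  ultimately have "\<bar>a\<bar> \<le> 2" "\<bar>b\<bar> \<le> 2" using abs_le_square_iff[of a 2] abs_le_square_iff[of b 2] by auto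
  then have "a \<in> {-2, -1, 0, 1, 2}" "b \<in> {-2, -1, 0, 1, 2}" by auto
  with ab consider "a = 2" "b = 0" | "a = -2" "b = 0" | "a = 0" "b = 2" | "a = 0" "b = -2" by auto
  moreover have sq: "(z ^ q)\<^sup>2 = (z\<^sup>2) ^ q" by (simp only: power_mult[symmetric] mult.commute)
  ultimately show ?thesis
  proof cases
    case 1
    then show ?thesis using a b by (simp add: complex_eq_iff)
  next
    case 2
    then have "z = - 1" using a b by (simp add: complex_eq_iff)
    with q show ?thesis by simp
  next
    case 3
    then have "z = \<i>" using a b by (simp add: complex_eq_iff)
    then have "(z ^ q)\<^sup>2 = (- 1) ^ q" using sq by simp
    with q show ?thesis by simp
  next
    case 4
    then have "z = - \<i>" using a b by (simp add: complex_eq_iff)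
    then have "(z ^ q)\<^sup>2 = (- 1) ^ q" using sq by simp
    with q show ?thesis by simp
  qed
qed

lemma gaussian_rationals_dense:
  assumes "e > 0"
  shows "\<exists>z\<in>gaussian_rationals. norm (z - w) < e"
proof -
  have "Re w - e / 2 < Re w" "Im w - e / 2 < Im w" using assms by auto
  then obtain a b where ab: "a \<in> \<rat>" "Re w - e / 2 < a" "a < Re w" "b \<in> \<rat>" "Im w - e / 2 < b" "b < Im w"
    using Rats_dense_in_real by metis
  have "norm (Complex a b - w) \<le> \<bar>a - Re w\<bar> + \<bar>b - Im w\<bar>"
    using cmod_le[of "Complex a b - w"] by simp
  also have "\<dots> < e" using ab by linarith
  finally show ?thesis using ab by (intro bexI[of _ "Complex a b"]) (auto simp: in_gaussian_rationals_iff)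
qed

lemma gaussian_approximate_roots_of_unity:
  assumes q: "2 < q"
  obtains x :: "nat \<Rightarrow> complex" where "\<And>k. x k \<in> gaussian_rationals"
    "(\<lambda>k. norm (x k ^ q - 1)) \<longlonglongrightarrow> 0" "\<not> (\<lambda>k. norm (x k - 1)) \<longlonglongrightarrow> 0"
proof -
  define w where "w = cis (2 * pi / q)"
  have "\<exists>z\<in>gaussian_rationals. norm (z - w) < 1 / Suc k" for k
    by (rule gaussian_rationals_dense) simp
  then obtain x where x: "\<And>k. x k \<in> gaussian_rationals" "\<And>k. norm (x k - w) < 1 / Suc k"
    by metis
  have "(\<lambda>k. norm (x k - w)) \<longlonglongrightarrow> 0"
    by (rule tendsto_sandwich[OF always_eventually always_eventually tendsto_const LIMSEQ_Suc[OF lim_1_over_n]])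
      (use x(2) less_imp_le in auto)
  then have lim: "x \<longlonglongrightarrow> w" by (simp add: tendsto_norm_zero_iff LIM_zero_iff)
  have "w ^ q = 1" using q by (simp add: w_def DeMoivre)
  then have "(\<lambda>k. norm (x k ^ q - 1)) \<longlonglongrightarrow> 0"
    using tendsto_power[OF lim, of q] by (simp add: tendsto_norm_zero_iff LIM_zero_iff)
  moreover have "\<not> (\<lambda>k. norm (x k - 1)) \<longlonglongrightarrow> 0"
  proof
    assume "(\<lambda>k. norm (x k - 1)) \<longlonglongrightarrow> 0"
    then have "x \<longlonglongrightarrow> 1" by (simp add: tendsto_norm_zero_iff LIM_zero_iff)
    then have "w = 1" using lim LIMSEQ_unique by blast
    then have "sin (2 * pi / q) = 0" by (simp add: w_def complex_eq_iff)
    moreover have "sin (2 * pi / q) > 0"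
      using q by (intro sin_gt_zero) (auto simp: field_simps)
    ultimately show False by simp
  qed
  ultimately show ?thesis using x(1) that by blast
qed

section \<open>Minimality of the triangular groups\<close>

text \<open>The two hypotheses say that, for every odd prime \<open>q\<close> dividing the size, a primitive \<open>q\<close>-th root of
  unity is missing in the field but present in its completion.\<close>

theorem (in triangular_group) minimal_iff_power_of_two:
  assumes roots: "\<And>q x. \<lbrakk>prime q; odd q; q dvd n; x \<in> K; x ^ q = 1\<rbrakk> \<Longrightarrow> x = 1"
    and approximate_roots: "\<And>q. \<lbrakk>prime q; odd q; q dvd n\<rbrakk> \<Longrightarrow>
      \<exists>x. (\<forall>k. x k \<in> K) \<and> (\<lambda>k. v (x k ^ q - 1)) \<longlonglongrightarrow> 0 \<and> \<not> (\<lambda>k. v (x k - 1)) \<longlonglongrightarrow> 0"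
  shows "minimal_topological_group G \<tau> \<longleftrightarrow> (\<exists>k. n = 2 ^ k)"
proof
  assume minimal: "minimal_topological_group G \<tau>"
  show "\<exists>k. n = 2 ^ k"
  proof (rule ccontr)
    assume "\<not> ?thesis"
    then obtain q where q: "prime q" "odd q" "q dvd n"
      using odd_prime_divisor_if_not_power_of_two[OF n_pos] by blast
    from approximate_roots[OF q] obtain x where x: "\<And>k. x k \<in> K"
      "vtendsto (\<lambda>k. x k ^ q) 1 sequentially" "\<not> vtendsto x 1 sequentially"
      unfolding vtendsto_def by blast
    have "0 < q" using q(1) by (rule prime_gt_0_nat)
    from not_minimal_if_missing_roots[OF this q(3) roots[OF q] x] minimal show False by blast
  qed
qed (use minimal_if_power_of_two in blast)

lemma minimal_padic_iff:
  assumes p: "prime p" "odd p"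
  shows "minimal_topological_group (ST_plus (p - 1) UNIV) (ST_plus_topology (p - 1) (padic_topology p)) \<longleftrightarrow>
    (\<exists>k. p - 1 = 2 ^ k)"
proof -
  have "2 < p" using p by (cases "p = 2") (auto dest: prime_gt_1_nat)
  interpret valued_subfield UNIV "padic_abs p" by (rule valued_subfield_padic[OF p(1)])
  interpret triangular_group UNIV "padic_abs p" "p - 1" "p - 2"
    by unfold_locales (use \<open>2 < p\<close> in auto)
  have "padic_dist p = (\<lambda>x y. padic_abs p (x - y))" by (simp add: fun_eq_iff padic_dist_def)
  then have "mtopology = padic_topology p" by (simp add: padic_topology_def)
  moreover have "minimal_topological_group G \<tau> \<longleftrightarrow> (\<exists>k. p - 1 = 2 ^ k)"
  proof (rule minimal_iff_power_of_two)
    show "x = 1" if "odd q" "x ^ q = 1" for q and x :: rat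
      using that by (rule odd_root_of_unity_rat)
    fix q assume q: "prime q" "odd q" "q dvd p - 1"
    obtain x where x: "(\<lambda>k. padic_abs p (x k ^ q - 1)) \<longlonglongrightarrow> 0" "\<And>k. padic_abs p (x k - 1) = 1"
      using padic_approximate_roots_of_unity[OF p(1) prime_gt_1_nat[OF q(1)] q(3)] by blast
    moreover from this have "\<not> (\<lambda>k. padic_abs p (x k - 1)) \<longlonglongrightarrow> 0" by (simp add: tendsto_const_iff)
    ultimately show "\<exists>x. (\<forall>k. x k \<in> UNIV) \<and> (\<lambda>k. padic_abs p (x k ^ q - 1)) \<longlonglongrightarrow> 0 \<and>
        \<not> (\<lambda>k. padic_abs p (x k - 1)) \<longlonglongrightarrow> 0"
      by blast
  qed
  ultimately show ?thesis by simp
qed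

lemma minimal_gaussian_iff:
  assumes n: "2 \<le> n"
  shows "minimal_topological_group (ST_plus n gaussian_rationals) (ST_plus_topology n gaussian_topology) \<longleftrightarrow>
    (\<exists>k. n = 2 ^ k)"
proof -
  interpret valued_subfield gaussian_rationals norm by (rule valued_subfield_gaussian)
  interpret triangular_group gaussian_rationals norm n "n - 1"
    by unfold_locales (use n in auto)
  interpret Submetric UNIV dist gaussian_rationals
    by unfold_locales (auto simp: dist_commute dist_triangle)
  have "(\<lambda>x y. norm (x - y)) = (dist :: complex \<Rightarrow> complex \<Rightarrow> real)" by (simp add: fun_eq_iff dist_norm)
  then have "mtopology = gaussian_topology"
    using mtopology_submetric by (simp add: gaussian_topology_def)
  moreover have "minimal_topological_group G \<tau> \<longleftrightarrow> (\<exists>k. n = 2 ^ k)"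
  proof (rule minimal_iff_power_of_two)
    show "x = 1" if "odd q" "x \<in> gaussian_rationals" "x ^ q = 1" for q x
      using that odd_root_of_unity_gaussian by blast
    fix q :: nat assume q: "prime q" "odd q"
    then have "2 < q" by (cases "q = 2") (auto dest: prime_gt_1_nat)
    then show "\<exists>x. (\<forall>k. x k \<in> gaussian_rationals) \<and> (\<lambda>k. norm (x k ^ q - 1)) \<longlonglongrightarrow> 0 \<and>
        \<not> (\<lambda>k. norm (x k - 1)) \<longlonglongrightarrow> 0"
      using gaussian_approximate_roots_of_unity by metis
  qed
  ultimately show ?thesis by simp
qed

theorem theorem2p8:
  fixes p :: nat
  assumes "prime p" and "odd p"
  shows "(fermat_prime p \<longleftrightarrow>
            minimal_topological_group (ST_plus (p - 1) (UNIV :: rat set))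
              (ST_plus_topology (p - 1) (padic_topology p))) \<and>
         (fermat_prime p \<longleftrightarrow>
            minimal_topological_group (ST_plus (p - 1) gaussian_rationals)
              (ST_plus_topology (p - 1) gaussian_topology))"
proof -
  have "2 < p" using assms by (cases "p = 2") (auto dest: prime_gt_1_nat)
  then have "2 \<le> p - 1" by simp
  then show ?thesis
    using minimal_padic_iff[OF assms] minimal_gaussian_iff[of "p - 1"]
      fermat_prime_iff_power_of_two[OF assms] by blast
qed

end
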